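(* For every hyperarithmetic (HYP) equivalence relation $E$ on $\omega$, there is a notation $a\in\mathcal{O}$ such that $E\le\mathrm{Id}^{\dotplus a}$. In particular, if $E$ is an equivalence relation on $\omega$ that is a fixed point of the jump, i.e. $E\equiv E^{\dotplus}$, then $R\le E$ for every HYP equivalence relation $R$ on $\omega$.
   Context: All equivalence relations have domain $\omega$. $W_e$ denotes the $e$th c.e. set and $\phi_e$ the $e$th partial computable function. $E\le R$ means there is a total computable $f$ with $x\mathrel{E}y\Leftrightarrow f(x)\mathrel{R}f(y)$ for all $x,y$; $E\equiv R$ means $E\le R$ and $R\le E$. $[S]_E$ is the $E$-closure of $S$. The jump $E^{\dotplus}$ is defined by $x\mathrel{E^{\dotplus}}y\Leftrightarrow [W_x]_E=[W_y]_E$. $\mathrm{Id}$ is the identity relation on $\omega$. $\mathcal{O}$ is Kleene's system of ordinal notations with order $<_{\mathcal O}$: $1$ denotes $0$; if $b$ denotes $\beta$ then $2^b$ denotes $\beta+1$; if $\phi_e$ is total with $\phi_e(n)<_{\mathcal O}\phi_e(n+1)$ for all $n$, then $3\cdot 5^e$ denotes $\sup_n|\phi_e(n)|$; $|a|$ is the ordinal denoted by $a$. For $a\in\mathcal O$ the iterated jump is defined by $E^{\dotplus 1}=E$ (here $1$ is the notation for $0$); $E^{\dotplus 2^b}=(E^{\dotplus b})^{\dotplus}$; $E^{\dotplus 3\cdot 5^e}=\oplus_i E^{\dotplus\phi_e(i)}$, where $\langle x,y\rangle\mathrel{\oplus_i E_i}\langle v,w\rangle$ iff $x=v$ and $y\mathrel{E_x}w$.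 An equivalence relation is HYP if it is hyperarithmetic (equivalently $\Delta^1_1$) as a set of pairs. *)

theory Defs
  imports Main "HOL-Library.Nat_Bijection"
begin

section \<open>Partial computable functions, relative to a set of natural numbers\<close>

text \<open>
  Programs for unary partial functions on the natural numbers. Several arguments are passed through
  the Cantor pairing \<^const>\<open>prod_encode\<close>, written \<open>\<llangle>x, y\<rrangle>\<close>; \<open>Query\<close> asks for the
  characteristic function of the set relative to which one computes.
\<close>

datatype prog =
    Zero
  | Succ
  | First
  | Second
  | Query
  | Tup prog prog
  | Comp prog prog
  | PrimRec prog prog
  | Mu prog

abbreviation pairing :: "nat \<Rightarrow> nat \<Rightarrow> nat"  ("\<llangle>_, _\<rrangle>") where
  "\<llangle>x, y\<rrangle> \<equiv> prod_encode (x, y)"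

text \<open>
  \<open>PrimRec p q\<close> maps \<open>\<llangle>x, 0\<rrangle>\<close> to \<open>p x\<close> and \<open>\<llangle>x, Suc k\<rrangle>\<close> to \<open>q \<llangle>x, \<llangle>k, r\<rrangle>\<rrangle>\<close>, where \<open>r\<close> is
  the value at \<open>\<llangle>x, k\<rrangle>\<close>. \<open>Mu p\<close> maps \<open>x\<close> to the least \<open>m\<close> with \<open>p \<llangle>x, m\<rrangle> = 0\<close>, provided \<open>p\<close>
  is defined at all \<open>\<llangle>x, k\<rrangle>\<close> with \<open>k < m\<close>.
\<close>

primrec run :: "nat set \<Rightarrow> prog \<Rightarrow> nat \<Rightarrow> nat option" where
  "run A Zero = (\<lambda>n. Some 0)"
| "run A Succ = (\<lambda>n. Some (Suc n))"
| "run A First = (\<lambda>n. Some (fst (prod_decode n)))"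
| "run A Second = (\<lambda>n. Some (snd (prod_decode n)))"
| "run A Query = (\<lambda>n. Some (if n \<in> A then 1 else 0))"
| "run A (Tup p q) =
     (\<lambda>n. Option.bind (run A p n) (\<lambda>x. Option.bind (run A q n) (\<lambda>y. Some \<llangle>x, y\<rrangle>)))"
| "run A (Comp p q) = (\<lambda>n. Option.bind (run A q n) (run A p))"
| "run A (PrimRec p q) =
     (\<lambda>n. case prod_decode n of (x, m) \<Rightarrow>
        rec_nat (run A p x) (\<lambda>k r. Option.bind r (\<lambda>i. run A q \<llangle>x, \<llangle>k, i\<rrangle>\<rrangle>)) m)"
| "run A (Mu p) =
     (\<lambda>n. let halts = (\<lambda>m. run A p \<llangle>n, m\<rrangle> = Some 0 \<and> (\<forall>k<m. run A p \<llangle>n, k\<rrangle> \<noteq> None))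
          in if \<exists>m. halts m then Some (LEAST m. halts m) else None)"

text \<open>The Goedel numbering is bijective (see \<open>bij_prog_encode\<close>), so every number is an index.\<close>

primrec prog_encode :: "prog \<Rightarrow> nat" where
  "prog_encode Zero = 0"
| "prog_encode Succ = 1"
| "prog_encode First = 2"
| "prog_encode Second = 3"
| "prog_encode Query = 4"
| "prog_encode (Tup p q) = 4 * \<llangle>prog_encode p, prog_encode q\<rrangle> + 5"
| "prog_encode (Comp p q) = 4 * \<llangle>prog_encode p, prog_encode q\<rrangle> + 6"
| "prog_encode (PrimRec p q) = 4 * \<llangle>prog_encode p, prog_encode q\<rrangle> + 7"
| "prog_encode (Mu p) = 4 * prog_encode p + 8"

definition prog_decode :: "nat \<Rightarrow> prog" where
  "prog_decode = inv prog_encode"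

definition phi_rel :: "nat set \<Rightarrow> nat \<Rightarrow> nat \<Rightarrow> nat option" where
  "phi_rel A e = run A (prog_decode e)"

definition phi :: "nat \<Rightarrow> nat \<Rightarrow> nat option" where
  "phi = phi_rel {}"

definition computable :: "(nat \<Rightarrow> nat) \<Rightarrow> bool" where
  "computable f \<longleftrightarrow> (\<exists>e. \<forall>n. phi e n = Some (f n))"

definition W :: "nat \<Rightarrow> nat set" where
  "W e = dom (phi e)"

definition turing_le :: "nat set \<Rightarrow> nat set \<Rightarrow> bool"  (infix "\<le>\<^sub>T" 50) where
  "A \<le>\<^sub>T B \<longleftrightarrow> (\<exists>e. \<forall>n. phi_rel B e n = Some (if n \<in> A then 1 else 0))"

definition turing_jump :: "nat set \<Rightarrow> nat set" where
  "turing_jump A = {e. phi_rel A e e \<noteq> None}"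


section \<open>Kleene's system of ordinal notations\<close>

inductive kleene_O :: "nat \<Rightarrow> bool" and kleene_less :: "nat \<Rightarrow> nat \<Rightarrow> bool"  (infix "<\<^sub>O" 50) where
  O_zero: "kleene_O 1"
| O_succ: "kleene_O b \<Longrightarrow> kleene_O (2 ^ b)"
| O_lim: "\<lbrakk>\<And>n. phi e n = Some (f n); \<And>n. f n <\<^sub>O f (Suc n)\<rbrakk> \<Longrightarrow> kleene_O (3 * 5 ^ e)"
| less_succ: "kleene_O b \<Longrightarrow> b <\<^sub>O 2 ^ b"
| less_lim: "\<lbrakk>\<And>n. phi e n = Some (f n); \<And>n. f n <\<^sub>O f (Suc n)\<rbrakk> \<Longrightarrow> f k <\<^sub>O 3 * 5 ^ e"
| less_trans: "\<lbrakk>a <\<^sub>O b; b <\<^sub>O c\<rbrakk> \<Longrightarrow> a <\<^sub>O c"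

text \<open>
  Recursion along \<^const>\<open>kleene_O\<close>, given by its graph: \<open>z\<close> is the value at the notation of \<open>0\<close>, \<open>s\<close>
  acts at successors, and \<open>l\<close> combines the values along the fundamental sequence of a limit notation.
  The recursion equations are \<open>O_rec_zero\<close>, \<open>O_rec_succ\<close> and \<open>O_rec_lim\<close>; the value at numbers outside
  \<^const>\<open>kleene_O\<close> is irrelevant.
\<close>

inductive O_rec_graph :: "'b \<Rightarrow> ('b \<Rightarrow> 'b) \<Rightarrow> ((nat \<Rightarrow> 'b) \<Rightarrow> 'b) \<Rightarrow> nat \<Rightarrow> 'b \<Rightarrow> bool"
  for z s l where
  graph_zero: "O_rec_graph z s l 1 z"
| graph_succ: "\<lbrakk>kleene_O b; O_rec_graph z s l b v\<rbrakk> \<Longrightarrow> O_rec_graph z s l (2 ^ b) (s v)"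
| graph_lim: "\<lbrakk>kleene_O (3 * 5 ^ e); \<And>n. phi e n = Some (f n); \<And>n. O_rec_graph z s l (f n) (F n)\<rbrakk>
    \<Longrightarrow> O_rec_graph z s l (3 * 5 ^ e) (l F)"

definition O_rec :: "'b \<Rightarrow> ('b \<Rightarrow> 'b) \<Rightarrow> ((nat \<Rightarrow> 'b) \<Rightarrow> 'b) \<Rightarrow> nat \<Rightarrow> 'b" where
  "O_rec z s l a = (THE v. O_rec_graph z s l a v)"


section \<open>Hyperarithmetic sets\<close>

definition H_set :: "nat \<Rightarrow> nat set" where
  "H_set = O_rec {} turing_jump (\<lambda>X. {\<llangle>n, x\<rrangle> | n x. x \<in> X n})"

definition hyperarithmetic :: "nat set \<Rightarrow> bool" where
  "hyperarithmetic X \<longleftrightarrow> (\<exists>a. kleene_O a \<and> X \<le>\<^sub>T H_set a)"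

definition HYP :: "nat rel \<Rightarrow> bool" where
  "HYP E \<longleftrightarrow> hyperarithmetic (prod_encode ` E)"


section \<open>Computable reducibility and the jump of relations on the natural numbers\<close>

definition reducible :: "nat rel \<Rightarrow> nat rel \<Rightarrow> bool"  (infix "\<preceq>" 50) where
  "E \<preceq> R \<longleftrightarrow> (\<exists>f. computable f \<and> (\<forall>x y. (x, y) \<in> E \<longleftrightarrow> (f x, f y) \<in> R))"

definition bireducible :: "nat rel \<Rightarrow> nat rel \<Rightarrow> bool"  (infix "\<approx>" 50) where
  "E \<approx> R \<longleftrightarrow> E \<preceq> R \<and> R \<preceq> E"

text \<open>For an equivalence relation \<open>E\<close>, the image \<open>E `` S\<close> is the \<open>E\<close>-closure of \<open>S\<close>.\<close>

definition jump :: "nat rel \<Rightarrow> nat rel" where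
  "jump E = {(x, y). E `` W x = E `` W y}"

definition direct_sum :: "(nat \<Rightarrow> nat rel) \<Rightarrow> nat rel" where
  "direct_sum E = {(\<llangle>x, y\<rrangle>, \<llangle>v, w\<rrangle>) | x y v w. x = v \<and> (y, w) \<in> E x}"

definition jump_iter :: "nat rel \<Rightarrow> nat \<Rightarrow> nat rel" where
  "jump_iter E = O_rec E jump direct_sum"


section \<open>The recursion equations and the bijectivity of the numbering\<close>

lemma prog_encode_inj: "prog_encode p = prog_encode q \<Longrightarrow> p = q"
proof (induction p arbitrary: q)
  case Zero then show ?case by (cases q) auto
next
  case Succ then show ?case by (cases q) auto
next
  case First then show ?case by (cases q) auto
next
  case Second then show ?case by (cases q) auto
next
  case Query then show ?case by (cases q) auto
next
  case (Tup p1 p2) then show ?case by (cases q) (auto, (presburger+)?)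
next
  case (Comp p1 p2) then show ?case by (cases q) (auto, (presburger+)?)
next
  case (PrimRec p1 p2) then show ?case by (cases q) (auto, (presburger+)?)
next
  case (Mu p) then show ?case by (cases q) (auto, (presburger+)?)
qed

lemma prog_encode_surj: "\<exists>p. prog_encode p = n"
proof (induction n rule: less_induct)
  case (less n)
  show ?case
  proof (cases "n < 5")
    case True
    then consider "n = 0" | "n = 1" | "n = 2" | "n = 3" | "n = 4" by linarith
    then show ?thesis by cases (metis prog_encode.simps(1-5))+
  next
    case False
    define m where "m = (n - 5) div 4"
    obtain x y where xy: "m = \<llangle>x, y\<rrangle>"
      by (metis prod_decode_inverse surj_pair)
    have "x \<le> m" "y \<le> m"
      using le_prod_encode_1[of x y] le_prod_encode_2[of y x] xy by auto
    moreover have "m < n" using False by (simp add: m_def)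
    ultimately obtain p q r
      where pqr: "prog_encode p = x" "prog_encode q = y" "prog_encode r = m"
      using less.IH le_less_trans by metis
    have "n = 4 * m + 5 \<or> n = 4 * m + 6 \<or> n = 4 * m + 7 \<or> n = 4 * m + 8"
      using False unfolding m_def by presburger
    then show ?thesis
      using pqr xy by (metis prog_encode.simps(6-9))
  qed
qed

lemma bij_prog_encode: "bij prog_encode"
  unfolding bij_def inj_def surj_def using prog_encode_inj prog_encode_surj by metis

lemma not_kleene_O_0: "\<not> kleene_O 0"
  by (auto elim: kleene_O.cases)

lemma kleene_less_O: "a <\<^sub>O b \<Longrightarrow> kleene_O a \<and> kleene_O b"
proof -
  have "(kleene_O a \<longrightarrow> True) \<and> (a <\<^sub>O b \<longrightarrow> kleene_O a \<and> kleene_O b)" for a b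
    by (rule kleene_O_kleene_less.induct) (auto intro: kleene_O_kleene_less.intros)
  then show "a <\<^sub>O b \<Longrightarrow> kleene_O a \<and> kleene_O b" by blast
qed

lemma three_five_not_pow_two: "3 * 5 ^ e \<noteq> (2::nat) ^ b"
proof
  assume eq: "3 * 5 ^ e = (2::nat) ^ b"
  have "odd (3 * 5 ^ e :: nat)" by simp
  with eq have "b = 0" by (cases b) auto
  with eq show False by simp
qed

lemma O_rec_graph_unique: "O_rec_graph z s l a v \<Longrightarrow> O_rec_graph z s l a w \<Longrightarrow> v = w"
proof (induction arbitrary: w rule: O_rec_graph.induct)
  case graph_zero
  from graph_zero.prems show ?case
  proof (cases rule: O_rec_graph.cases)
    case (graph_succ b v)
    then have "b = 0" by (cases b) auto
    then show ?thesis using graph_succ not_kleene_O_0 by blast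
  qed auto
next
  case (graph_succ b v)
  have "b \<noteq> 0" using graph_succ.hyps not_kleene_O_0 by metis
  from graph_succ.prems show ?case
  proof (cases rule: O_rec_graph.cases)
    case graph_zero
    then show ?thesis using \<open>b \<noteq> 0\<close> by simp
  next
    case (graph_succ b' v')
    then show ?thesis using local.graph_succ.IH by simp
  next
    case (graph_lim e f F)
    then show ?thesis using three_five_not_pow_two by metis
  qed
next
  case (graph_lim e f F)
  from graph_lim.prems show ?case
  proof (cases rule: O_rec_graph.cases)
    case graph_zero
    then show ?thesis by simp
  next
    case (graph_succ b' v')
    then show ?thesis using three_five_not_pow_two by metis
  next
    case (graph_lim e' f' F')
    then have "f = f'"
      using local.graph_lim.hyps by (auto simp: fun_eq_iff)
    then have "F = F'"
      using graph_lim local.graph_lim.IH by (auto simp: fun_eq_iff)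
    then show ?thesis using graph_lim by simp
  qed
qed

lemma O_rec_graph_total: "kleene_O a \<Longrightarrow> \<exists>v. O_rec_graph z s l a v"
proof -
  have "(kleene_O a \<longrightarrow> (\<exists>v. O_rec_graph z s l a v)) \<and>
        (a <\<^sub>O b \<longrightarrow> (\<exists>v. O_rec_graph z s l a v) \<and> (\<exists>v. O_rec_graph z s l b v))" for a b
  proof (rule kleene_O_kleene_less.induct)
    fix e f
    assume f: "\<And>n. phi e n = Some (f n)"
      and less: "\<And>n. f n <\<^sub>O f (Suc n)"
      and IH: "\<And>n. (\<exists>v. O_rec_graph z s l (f n) v) \<and> (\<exists>v. O_rec_graph z s l (f (Suc n)) v)"
    from IH obtain F where "\<And>n. O_rec_graph z s l (f n) (F n)" by metis
    with f less show *: "\<exists>v. O_rec_graph z s l (3 * 5 ^ e) v"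
      by (meson O_lim graph_lim)
    show "(\<exists>v. O_rec_graph z s l (f k) v) \<and> (\<exists>v. O_rec_graph z s l (3 * 5 ^ e) v)" for k
      using IH * by blast
  qed (blast intro: graph_zero graph_succ)+
  then show "kleene_O a \<Longrightarrow> \<exists>v. O_rec_graph z s l a v" by blast
qed

lemma O_rec_graph_O_rec: "kleene_O a \<Longrightarrow> O_rec_graph z s l a (O_rec z s l a)"
  unfolding O_rec_def
  by (metis O_rec_graph_total O_rec_graph_unique theI)

lemma O_rec_eqI: "O_rec_graph z s l a v \<Longrightarrow> O_rec z s l a = v"
  unfolding O_rec_def using O_rec_graph_unique by (metis the_equality)

lemma O_rec_zero: "O_rec z s l 1 = z"
  by (intro O_rec_eqI graph_zero)

lemma O_rec_succ: "kleene_O b \<Longrightarrow> O_rec z s l (2 ^ b) = s (O_rec z s l b)"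
  by (intro O_rec_eqI graph_succ O_rec_graph_O_rec)

lemma O_rec_lim:
  assumes "\<And>n. phi e n = Some (f n)" and "\<And>n. f n <\<^sub>O f (Suc n)"
  shows "O_rec z s l (3 * 5 ^ e) = l (\<lambda>n. O_rec z s l (f n))"
proof (intro O_rec_eqI graph_lim)
  show "kleene_O (3 * 5 ^ e)" using assms by (rule O_lim)
  show "phi e n = Some (f n)" for n by (rule assms)
  show "O_rec_graph z s l (f n) (O_rec z s l (f n))" for n
    using kleene_less_O[OF assms(2)] by (blast intro: O_rec_graph_O_rec)
qed

lemma jump_iter_zero: "jump_iter E 1 = E"
  unfolding jump_iter_def by (rule O_rec_zero)

lemma jump_iter_succ: "kleene_O b \<Longrightarrow> jump_iter E (2 ^ b) = jump (jump_iter E b)"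
  unfolding jump_iter_def by (rule O_rec_succ)

lemma jump_iter_lim:
  assumes "\<And>n. phi e n = Some (f n)" and "\<And>n. f n <\<^sub>O f (Suc n)"
  shows "jump_iter E (3 * 5 ^ e) = direct_sum (\<lambda>n. jump_iter E (f n))"
  unfolding jump_iter_def using assms by (rule O_rec_lim)

end

theory Submission
  imports Defs
begin

text \<open>
  A truth value is coded in an equivalence relation by two fixed inequivalent classes. If \<open>f\<close> codes
  membership in \<open>A\<close> in this sense, then taking c.e. sets of such codes one level up expresses
  quantification over computable families of statements: a set that always contains the code of
  "false" contains the code of "true" iff some statement in the family holds. Since a halting
  oracle computation uses only finitely many oracle answers, three jumps suffice to pass from \<open>A\<close> to
  its Turing jump, and at a limit two jumps replace level-dependent codes of truth by uniform ones.
  Effective recursion along Kleene's notations then codes every \<open>H\<close>-set in some iterated jump \<open>R b\<close>. For a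
  hyperarithmetic \<open>X\<close> one sends \<open>x\<close> to the set of all codes of the pairs of \<open>y\<close> and the truth value
  of \<open>x X y\<close>, where \<open>y\<close> is remembered as a position in a direct sum.

  The argument only uses computable maps that turn jumps and direct sums into the next relation of a
  family. The iterated jumps of the identity form such a family, but so does a single relation \<open>E\<close>
  whose jump reduces to \<open>E\<close>: numerals and Kuratowski pairs inside \<open>E\<close> absorb the direct sums. This
  yields both halves of the theorem at once.
\<close>


section \<open>Closure properties of computable functions\<close>

abbreviation p1 :: "nat \<Rightarrow> nat" where "p1 x \<equiv> fst (prod_decode x)"
abbreviation p2 :: "nat \<Rightarrow> nat" where "p2 x \<equiv> snd (prod_decode x)"

lemma prog_decode_encode [simp]: "prog_decode (prog_encode p) = p"
  unfolding prog_decode_def by (rule inv_f_f) (use bij_prog_encode in \<open>simp add: bij_def\<close>)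

lemma prog_encode_decode [simp]: "prog_encode (prog_decode e) = e"
  unfolding prog_decode_def by (rule surj_f_inv_f) (use bij_prog_encode in \<open>simp add: bij_def\<close>)

lemma phi_eq_run: "phi e = run {} (prog_decode e)"
  by (simp add: phi_def phi_rel_def)

lemma phi_prog_encode [simp]: "phi (prog_encode p) = run {} p"
  by (simp add: phi_eq_run)

lemma computable_iff_run: "computable f \<longleftrightarrow> (\<exists>p. \<forall>n. run {} p n = Some (f n))"
  unfolding computable_def by (metis phi_eq_run phi_prog_encode)

text \<open>Splitting a number and pairing its halves again is the identity; later programs use
  \<open>Tup First Second\<close> in the same way to pass on their input.\<close>

lemma computable_id: "computable (\<lambda>x. x)"
  unfolding computable_iff_run by (rule exI[of _ "Tup First Second"]) simp

lemma computable_const: "computable (\<lambda>x. c)"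
proof (induction c)
  case 0
  show ?case unfolding computable_iff_run by (rule exI[of _ Zero]) simp
next
  case (Suc c)
  then obtain p where "\<forall>n. run {} p n = Some c" unfolding computable_iff_run by blast
  then show ?case unfolding computable_iff_run by (intro exI[of _ "Comp Succ p"]) simp
qed

lemma computable_comp:
  assumes "computable f" and "computable g"
  shows "computable (\<lambda>x. f (g x))"
proof -
  obtain p q where "\<forall>n. run {} p n = Some (f n)" "\<forall>n. run {} q n = Some (g n)"
    using assms unfolding computable_iff_run by blast
  then show ?thesis unfolding computable_iff_run by (intro exI[of _ "Comp p q"]) simp
qed

lemma computable_Suc: "computable f \<Longrightarrow> computable (\<lambda>x. Suc (f x))"
  by (rule computable_comp[of Suc]) (auto simp: computable_iff_run intro: exI[of _ Succ])

lemma computable_p1: "computable f \<Longrightarrow> computable (\<lambda>x. p1 (f x))"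
  by (rule computable_comp[of p1]) (auto simp: computable_iff_run intro: exI[of _ First])

lemma computable_p2: "computable f \<Longrightarrow> computable (\<lambda>x. p2 (f x))"
  by (rule computable_comp[of p2]) (auto simp: computable_iff_run intro: exI[of _ Second])

lemma computable_pairing:
  assumes "computable f" and "computable g"
  shows "computable (\<lambda>x. \<llangle>f x, g x\<rrangle>)"
proof -
  obtain p q where "\<forall>n. run {} p n = Some (f n)" "\<forall>n. run {} q n = Some (g n)"
    using assms unfolding computable_iff_run by blast
  then show ?thesis unfolding computable_iff_run by (intro exI[of _ "Tup p q"]) simp
qed

lemma computable_rec_nat:
  assumes "computable p" and "computable (\<lambda>y. q (p1 y) (p1 (p2 y)) (p2 (p2 y)))" and "computable m"
  shows "computable (\<lambda>x. rec_nat (p x) (q x) (m x))"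
proof -
  obtain P Q M where PQM: "\<And>n. run {} P n = Some (p n)"
      "\<And>y. run {} Q y = Some (q (p1 y) (p1 (p2 y)) (p2 (p2 y)))"
      "\<And>n. run {} M n = Some (m n)"
    using assms unfolding computable_iff_run by blast
  have "rec_nat (run {} P x) (\<lambda>k r. Option.bind r (\<lambda>i. run {} Q \<llangle>x, \<llangle>k, i\<rrangle>\<rrangle>)) j
      = Some (rec_nat (p x) (q x) j)" for x j
    by (induction j) (simp_all add: PQM)
  then show ?thesis unfolding computable_iff_run
    by (intro exI[of _ "Comp (PrimRec P Q) (Tup (Tup First Second) M)"]) (simp add: PQM)
qed

lemmas computable_basic =
  computable_id computable_const computable_Suc computable_p1 computable_p2 computable_pairing

lemma computable_case_nat:
  assumes "computable f" "computable (\<lambda>y. g (p1 y) (p2 y))" "computable m"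
  shows "computable (\<lambda>x. case m x of 0 \<Rightarrow> f x | Suc k \<Rightarrow> g x k)"
proof -
  have "computable (\<lambda>y. g (p1 y) (p1 (p2 y)))"
    by (rule computable_comp[OF assms(2), of "\<lambda>y. \<llangle>p1 y, p1 (p2 y)\<rrangle>", simplified])
      (intro computable_basic)
  then have "computable (\<lambda>x. rec_nat (f x) (\<lambda>k r. g x k) (m x))"
    by (intro computable_rec_nat assms)
  moreover have "rec_nat (f x) (\<lambda>k r. g x k) (m x) = (case m x of 0 \<Rightarrow> f x | Suc k \<Rightarrow> g x k)" for x
    by (cases "m x") simp_all
  ultimately show ?thesis by simp
qed

lemma computable_add:
  assumes "computable f" "computable g" shows "computable (\<lambda>x. f x + g x)"
proof -
  have "rec_nat a (\<lambda>k. Suc) b = a + b" for a b by (induction b) simp_all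
  then show ?thesis
    using computable_rec_nat[OF assms(1) _ assms(2), of "\<lambda>x k r. Suc r"] by (simp add: computable_basic)
qed

lemma computable_mult:
  assumes "computable f" "computable g" shows "computable (\<lambda>x. f x * g x)"
proof -
  have "rec_nat 0 (\<lambda>k r. r + a) b = a * b" for a b by (induction b) simp_all
  moreover have "computable (\<lambda>x. p2 (p2 x) + f (p1 x))"
    by (intro computable_add computable_comp[OF assms(1)] computable_basic)
  ultimately show ?thesis
    using computable_rec_nat[OF computable_const[of 0] _ assms(2), of "\<lambda>x k r. r + f x"] by simp
qed

lemma computable_power:
  assumes "computable f" "computable g" shows "computable (\<lambda>x. f x ^ g x)"
proof -
  have "rec_nat 1 (\<lambda>k r. r * a) b = a ^ b" for a b :: nat by (induction b) simp_all
  moreover have "computable (\<lambda>x. p2 (p2 x) * f (p1 x))"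
    by (intro computable_mult computable_comp[OF assms(1)] computable_basic)
  ultimately show ?thesis
    using computable_rec_nat[OF computable_const[of 1] _ assms(2), of "\<lambda>x k r. r * f x"] by simp
qed

lemma computable_diff:
  assumes "computable f" "computable g" shows "computable (\<lambda>x. f x - g x)"
proof -
  have pred: "computable (\<lambda>x. x - 1)"
  proof -
    have "computable (\<lambda>x. case x of 0 \<Rightarrow> 0 | Suc k \<Rightarrow> k)"
      by (intro computable_case_nat computable_basic)
    moreover have "(case x of 0 \<Rightarrow> 0 | Suc k \<Rightarrow> k) = x - 1" for x by (cases x) simp_all
    ultimately show ?thesis by simp
  qed
  have "rec_nat a (\<lambda>k r. r - 1) b = a - b" for a b by (induction b) simp_all
  moreover have "computable (\<lambda>x. p2 (p2 x) - 1)"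
    by (intro computable_comp[OF pred] computable_basic)
  ultimately show ?thesis
    using computable_rec_nat[OF assms(1) _ assms(2), of "\<lambda>x k r. r - 1"] by simp
qed

section \<open>Decidable predicates, definition by cases and bounded arithmetic\<close>

definition decidable :: "(nat \<Rightarrow> bool) \<Rightarrow> bool" where
  "decidable P \<longleftrightarrow> computable (\<lambda>x. if P x then 1 else 0)"

text \<open>Both branches are total, so both may be evaluated and the choice made by multiplying
  with the characteristic values.\<close>

lemma computable_if:
  assumes "decidable P" "computable f" "computable g"
  shows "computable (\<lambda>x. if P x then f x else g x)"
proof -
  have "computable (\<lambda>x. (if P x then 1 else 0) * f x + (1 - (if P x then 1 else 0)) * g x)"
    using assms unfolding decidable_def
    by (intro computable_add computable_mult computable_diff computable_const)
  moreover have "(if P x then 1 else 0) * f x + (1 - (if P x then 1 else 0)) * g x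
      = (if P x then f x else g x)" for x by simp
  ultimately show ?thesis by (simp cong: if_cong)
qed

lemma decidable_le:
  assumes "computable f" "computable g" shows "decidable (\<lambda>x. f x \<le> g x)"
proof -
  have "computable (\<lambda>x. 1 - (f x - g x))"
    by (intro computable_diff computable_const assms)
  moreover have "1 - (f x - g x) = (if f x \<le> g x then 1 else 0)" for x by auto
  ultimately show ?thesis by (simp add: decidable_def)
qed

lemma decidable_less:
  assumes "computable f" "computable g" shows "decidable (\<lambda>x. f x < g x)"
  using decidable_le[OF computable_Suc[OF assms(1)] assms(2)] by (simp add: Suc_le_eq)

lemma decidable_conj:
  assumes "decidable P" "decidable Q" shows "decidable (\<lambda>x. P x \<and> Q x)"
proof -
  have "computable (\<lambda>x. if P x then if Q x then 1 else 0 else 0)"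
    by (intro computable_if computable_const assms)
  moreover have "(if P x then if Q x then 1 else 0 else 0) = (if P x \<and> Q x then 1 else (0::nat))" for x
    by simp
  ultimately show ?thesis by (simp add: decidable_def)
qed

lemma decidable_eq:
  assumes "computable f" "computable g" shows "decidable (\<lambda>x. f x = g x)"
  using decidable_conj[OF decidable_le[OF assms] decidable_le[OF assms(2,1)]]
  by (simp add: eq_iff)

lemma if_not_swap: "(if \<not> P then x else y) = (if P then y else x)"
  by simp

lemma decidable_not:
  assumes "decidable P" shows "decidable (\<lambda>x. \<not> P x)"
  using computable_if[OF assms computable_const[of 0] computable_const[of 1]]
  unfolding decidable_def by (simp add: if_not_swap)

lemma computable_sum:
  assumes "computable (\<lambda>y. f (p1 y) (p2 y))" "computable m"
  shows "computable (\<lambda>x. \<Sum>i<m x. f x i)"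
proof -
  have "computable (\<lambda>y. f (p1 y) (p1 (p2 y)))"
    by (rule computable_comp[OF assms(1), of "\<lambda>y. \<llangle>p1 y, p1 (p2 y)\<rrangle>", simplified])
      (intro computable_basic)
  then have "computable (\<lambda>x. rec_nat 0 (\<lambda>k r. r + f x k) (m x))"
    by (intro computable_rec_nat computable_add computable_basic assms)
  moreover have "rec_nat 0 (\<lambda>k r. r + f x k) j = (\<Sum>i<j. f x i)" for x j
    by (induction j) simp_all
  ultimately show ?thesis by simp
qed

text \<open>Turns a bounded sum into a bounded search for a unique witness. Division and the
  decoding of notations are obtained this way.\<close>

lemma sum_delta_below:
  fixes F :: "nat \<Rightarrow> nat"
  assumes "\<And>i. P i \<longleftrightarrow> i = k" "k < m"
  shows "(\<Sum>i<m. if P i then F i else 0) = F k"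
  using assms by (simp add: sum.delta)

lemma computable_div:
  assumes "computable f" "computable g" shows "computable (\<lambda>x. f x div g x)"
proof -
  have "computable (\<lambda>x. if g x = 0 then 0 else \<Sum>i<Suc (f x). if g x * i \<le> f x \<and> f x < g x * Suc i then i else 0)"
    by (intro computable_if computable_sum decidable_eq decidable_conj decidable_le decidable_less
        computable_mult computable_basic computable_comp[OF assms(1)] computable_comp[OF assms(2)])
  moreover have "(if g x = 0 then 0 else \<Sum>i<Suc (f x). if g x * i \<le> f x \<and> f x < g x * Suc i then i else 0)
      = f x div g x" for x
  proof (cases "g x = 0")
    case False
    have "g x * i \<le> f x \<and> f x < g x * Suc i \<longleftrightarrow> i = f x div g x" for i
      using False by (metis div_nat_eqI dividend_less_times_div mult.commute mult_Suc_right neq0_conv times_div_less_eq_dividend)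
    moreover have "f x div g x < Suc (f x)" by (simp add: le_imp_less_Suc)
    ultimately show ?thesis
      using sum_delta_below[of "\<lambda>i. g x * i \<le> f x \<and> f x < g x * Suc i" "f x div g x" "Suc (f x)" "\<lambda>i. i"] False by simp
  qed simp
  ultimately show ?thesis by simp
qed

lemma computable_mod:
  assumes "computable f" "computable g" shows "computable (\<lambda>x. f x mod g x)"
  unfolding minus_mult_div_eq_mod[symmetric]
  by (intro computable_diff computable_mult computable_div assms)

lemmas computable_intros =
  computable_basic computable_add computable_mult computable_power computable_diff computable_if
  computable_div computable_mod decidable_le decidable_less decidable_conj decidable_eq decidable_not


section \<open>A universal machine with a finite oracle\<close>

text \<open>A state is a stack followed by a tagged argument: tag 0 marks a value being returned,
  tag \<open>Suc e\<close> a call of program \<open>e\<close>. The number 0 is the empty stack,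
  hence the \<open>Suc\<close> in \<open>push\<close>.\<close>

abbreviation eval_state :: "nat \<Rightarrow> nat \<Rightarrow> nat \<Rightarrow> nat" where
  "eval_state e n K \<equiv> \<llangle>K, \<llangle>Suc e, n\<rrangle>\<rrangle>"

abbreviation return_state :: "nat \<Rightarrow> nat \<Rightarrow> nat" where
  "return_state v K \<equiv> \<llangle>K, \<llangle>0, v\<rrangle>\<rrangle>"

abbreviation push :: "nat \<Rightarrow> nat \<Rightarrow> nat \<Rightarrow> nat \<Rightarrow> nat" where
  "push kind e d K \<equiv> Suc \<llangle>\<llangle>kind, \<llangle>e, d\<rrangle>\<rrangle>, K\<rrangle>"

text \<open>
  An oracle code \<open>\<llangle>g, t\<rrangle>\<close> stands for the finite partial function sending \<open>n < t\<close> to the \<open>n\<close>-th binary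
  digit of \<open>g\<close>; the machine gets stuck on queries \<open>n \<ge> t\<close>.
  Stack frames: 0 = pending outer function of \<open>Comp\<close>, 1 and 2 = pending second and first component
  of \<open>Tup\<close>, 3 = \<open>PrimRec\<close> loop with data \<open>\<llangle>x, \<llangle>rounds done, rounds left\<rrangle>\<rrangle>\<close>, 4 = \<open>Mu\<close> search with data
  \<open>\<llangle>argument, current candidate\<rrangle>\<close>.
\<close>

definition eval_step :: "nat \<Rightarrow> nat \<Rightarrow> nat \<Rightarrow> nat \<Rightarrow> nat" where
  "eval_step z e n K =
    (if e = 0 then return_state 0 K
     else if e = 1 then return_state (Suc n) K
     else if e = 2 then return_state (p1 n) K
     else if e = 3 then return_state (p2 n) K
     else if e = 4 then
       (if n < p2 z then return_state (p1 z div 2 ^ n mod 2) K else eval_state e n K)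
     else if (e - 5) mod 4 = 0 then eval_state (p1 ((e - 5) div 4)) n (push 1 (p2 ((e - 5) div 4)) n K)
     else if (e - 5) mod 4 = 1 then eval_state (p2 ((e - 5) div 4)) n (push 0 (p1 ((e - 5) div 4)) 0 K)
     else if (e - 5) mod 4 = 2 then
       eval_state (p1 ((e - 5) div 4)) (p1 n) (push 3 (p2 ((e - 5) div 4)) \<llangle>p1 n, \<llangle>0, p2 n\<rrangle>\<rrangle> K)
     else eval_state ((e - 5) div 4) \<llangle>n, 0\<rrangle> (push 4 ((e - 5) div 4) \<llangle>n, 0\<rrangle> K))"

definition return_step :: "nat \<Rightarrow> nat \<Rightarrow> nat \<Rightarrow> nat \<Rightarrow> nat \<Rightarrow> nat" where
  "return_step v kind e d K =
    (if kind = 0 then eval_state e v K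
     else if kind = 1 then eval_state e d (push 2 v 0 K)
     else if kind = 2 then return_state \<llangle>e, v\<rrangle> K
     else if kind = 3 then
       (if p2 (p2 d) = 0 then return_state v K
        else eval_state e \<llangle>p1 d, \<llangle>p1 (p2 d), v\<rrangle>\<rrangle>
          (push 3 e \<llangle>p1 d, \<llangle>Suc (p1 (p2 d)), p2 (p2 d) - 1\<rrangle>\<rrangle> K))
     else if v = 0 then return_state (p2 d) K
     else eval_state e \<llangle>p1 d, Suc (p2 d)\<rrangle> (push 4 e \<llangle>p1 d, Suc (p2 d)\<rrangle> K))"

text \<open>A value returned to the empty stack is a fixed point, so a result persists through all
  further steps.\<close>

definition step :: "nat \<Rightarrow> nat \<Rightarrow> nat" where
  "step z st =
    (if p1 (p2 st) \<noteq> 0 then eval_step z (p1 (p2 st) - 1) (p2 (p2 st)) (p1 st)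
     else if p1 st = 0 then st
     else return_step (p2 (p2 st)) (p1 (p1 (p1 st - 1))) (p1 (p2 (p1 (p1 st - 1))))
       (p2 (p2 (p1 (p1 st - 1)))) (p2 (p1 st - 1)))"

lemma computable_eval_step:
  assumes "computable z" "computable e" "computable n" "computable K"
  shows "computable (\<lambda>x. eval_step (z x) (e x) (n x) (K x))"
  unfolding eval_step_def by (intro computable_intros assms)

lemma computable_return_step:
  assumes "computable v" "computable kind" "computable e" "computable d" "computable K"
  shows "computable (\<lambda>x. return_step (v x) (kind x) (e x) (d x) (K x))"
  unfolding return_step_def by (intro computable_intros assms)

lemma computable_step:
  assumes "computable z" "computable st"
  shows "computable (\<lambda>x. step (z x) (st x))"
  unfolding step_def
  by (intro computable_eval_step computable_return_step computable_intros assms)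

lemma computable_step_funpow:
  assumes "computable z" "computable s" "computable st"
  shows "computable (\<lambda>x. (step (z x) ^^ s x) (st x))"
proof -
  have "computable (\<lambda>x. rec_nat (st x) (\<lambda>k r. step (z x) r) (s x))"
    by (intro computable_rec_nat computable_step computable_basic assms computable_comp[OF assms(1)])
  moreover have "rec_nat a (\<lambda>k r. step w r) j = (step w ^^ j) a" for a w j
    by (induction j) simp_all
  ultimately show ?thesis by simp
qed

text \<open>Subtracting 5 from the codes of \<open>Tup\<close>, \<open>Comp\<close>,
  \<open>PrimRec\<close> and \<open>Mu\<close> leaves the residues 0, 1, 2, 3 modulo 4 with the
  payload as quotient; \<open>eval_step\<close> recognises the constructors by this.\<close>

lemma step_eval:
  "step z (eval_state (prog_encode Zero) n K) = return_state 0 K"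
  "step z (eval_state (prog_encode Succ) n K) = return_state (Suc n) K"
  "step z (eval_state (prog_encode First) n K) = return_state (p1 n) K"
  "step z (eval_state (prog_encode Second) n K) = return_state (p2 n) K"
  "step z (eval_state (prog_encode Query) n K) =
     (if n < p2 z then return_state (if n \<in> set_decode (p1 z) then 1 else 0) K
      else eval_state (prog_encode Query) n K)"
  "step z (eval_state (prog_encode (Tup p q)) n K) =
     eval_state (prog_encode p) n (push 1 (prog_encode q) n K)"
  "step z (eval_state (prog_encode (Comp p q)) n K) =
     eval_state (prog_encode q) n (push 0 (prog_encode p) 0 K)"
  "step z (eval_state (prog_encode (PrimRec p q)) n K) =
     eval_state (prog_encode p) (p1 n) (push 3 (prog_encode q) \<llangle>p1 n, \<llangle>0, p2 n\<rrangle>\<rrangle> K)"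
  "step z (eval_state (prog_encode (Mu p)) n K) =
     eval_state (prog_encode p) \<llangle>n, 0\<rrangle> (push 4 (prog_encode p) \<llangle>n, 0\<rrangle> K)"
proof -
  have 1: "4 * m + 5 - 5 = 4 * m" "4 * m + 6 - 5 = 4 * m + 1" "4 * m + 7 - 5 = 4 * m + 2"
    "4 * m + 8 - 5 = 4 * m + 3" for m :: nat
    by simp_all
  have 2: "4 * m mod 4 = 0" "(4 * m + 1) mod 4 = 1" "(4 * m + 2) mod 4 = 2" "(4 * m + 3) mod 4 = 3"
    "4 * m div 4 = m" "(4 * m + 1) div 4 = m" "(4 * m + 2) div 4 = m" "(4 * m + 3) div 4 = m" for m :: nat
    by (simp_all del: add_2_eq_Suc' add_2_eq_Suc)
  show
  "step z (eval_state (prog_encode Zero) n K) = return_state 0 K"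
  "step z (eval_state (prog_encode Succ) n K) = return_state (Suc n) K"
  "step z (eval_state (prog_encode First) n K) = return_state (p1 n) K"
  "step z (eval_state (prog_encode Second) n K) = return_state (p2 n) K"
  "step z (eval_state (prog_encode Query) n K) =
     (if n < p2 z then return_state (if n \<in> set_decode (p1 z) then 1 else 0) K
      else eval_state (prog_encode Query) n K)"
    by (simp_all add: step_def eval_step_def set_decode_def odd_iff_mod_2_eq_one)
  show
  "step z (eval_state (prog_encode (Tup p q)) n K) =
     eval_state (prog_encode p) n (push 1 (prog_encode q) n K)"
  "step z (eval_state (prog_encode (Comp p q)) n K) =
     eval_state (prog_encode q) n (push 0 (prog_encode p) 0 K)"
  "step z (eval_state (prog_encode (PrimRec p q)) n K) =
     eval_state (prog_encode p) (p1 n) (push 3 (prog_encode q) \<llangle>p1 n, \<llangle>0, p2 n\<rrangle>\<rrangle> K)"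
  "step z (eval_state (prog_encode (Mu p)) n K) =
     eval_state (prog_encode p) \<llangle>n, 0\<rrangle> (push 4 (prog_encode p) \<llangle>n, 0\<rrangle> K)"
    unfolding step_def eval_step_def prog_encode.simps by (simp_all only: prod_encode_inverse fst_conv snd_conv diff_Suc_1 1 2) simp_all
qed

lemma step_return:
  "step z (return_state v 0) = return_state v 0"
  "step z (return_state v (push 0 e d K)) = eval_state e v K"
  "step z (return_state v (push 1 e d K)) = eval_state e d (push 2 v 0 K)"
  "step z (return_state v (push 2 e d K)) = return_state \<llangle>e, v\<rrangle> K"
  "step z (return_state v (push 3 e \<llangle>x, \<llangle>k, 0\<rrangle>\<rrangle> K)) = return_state v K"
  "step z (return_state v (push 3 e \<llangle>x, \<llangle>k, Suc j\<rrangle>\<rrangle> K)) =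
     eval_state e \<llangle>x, \<llangle>k, v\<rrangle>\<rrangle> (push 3 e \<llangle>x, \<llangle>Suc k, j\<rrangle>\<rrangle> K)"
  "step z (return_state 0 (push 4 e \<llangle>x, m\<rrangle> K)) = return_state m K"
  "step z (return_state (Suc v) (push 4 e \<llangle>x, m\<rrangle> K)) =
     eval_state e \<llangle>x, Suc m\<rrangle> (push 4 e \<llangle>x, Suc m\<rrangle> K)"
  by (simp_all add: step_def return_step_def)

subsection \<open>Completeness and soundness of the machine\<close>

definition agrees :: "nat \<Rightarrow> nat set \<Rightarrow> bool" where
  "agrees z A \<longleftrightarrow> (\<forall>n < p2 z. n \<in> set_decode (p1 z) \<longleftrightarrow> n \<in> A)"

definition reaches :: "nat \<Rightarrow> nat \<Rightarrow> nat \<Rightarrow> bool" where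
  "reaches z st st' \<longleftrightarrow> (\<exists>s. (step z ^^ s) st = st')"

lemma reaches_refl: "reaches z st st"
  unfolding reaches_def by (rule exI[of _ 0]) simp

lemma reaches_trans: "reaches z a b \<Longrightarrow> reaches z b c \<Longrightarrow> reaches z a c"
  unfolding reaches_def by (metis comp_apply funpow_add)

lemma reaches_step: "reaches z (step z a) b \<Longrightarrow> reaches z a b"
  unfolding reaches_def by (metis comp_apply funpow_Suc_right)

text \<open>The use principle: a convergent computation consults only a finite part of
  \<open>A\<close>, so every sufficiently long correct finite oracle yields the same value. The
  stack \<open>K\<close> is arbitrary to allow nested calls.\<close>

definition evaluates :: "nat set \<Rightarrow> prog \<Rightarrow> nat \<Rightarrow> nat \<Rightarrow> bool" where
  "evaluates A p n v \<longleftrightarrow> (\<exists>N. \<forall>z. agrees z A \<and> p2 z \<ge> N \<longrightarrow>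
     (\<forall>K. reaches z (eval_state (prog_encode p) n K) (return_state v K)))"

text \<open>Induction on the rounds \<open>m\<close> already done, with any number \<open>j\<close>
  of rounds left; passing from \<open>m\<close> to \<open>Suc m\<close> uses the hypothesis at
  \<open>Suc j\<close>.\<close>

lemma PrimRec_loop_reaches:
  assumes "\<And>k i v. run A q \<llangle>x, \<llangle>k, i\<rrangle>\<rrangle> = Some v \<Longrightarrow> evaluates A q \<llangle>x, \<llangle>k, i\<rrangle>\<rrangle> v"
  defines "F \<equiv> \<lambda>k r. Option.bind r (\<lambda>i. run A q \<llangle>x, \<llangle>k, i\<rrangle>\<rrangle>)"
  assumes "rec_nat (Some r) F m = Some v"
  shows "\<exists>N. \<forall>z. agrees z A \<and> p2 z \<ge> N \<longrightarrow>
    (\<forall>j K. reaches z (return_state r (push 3 (prog_encode q) \<llangle>x, \<llangle>0, m + j\<rrangle>\<rrangle> K))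
                   (return_state v (push 3 (prog_encode q) \<llangle>x, \<llangle>m, j\<rrangle>\<rrangle> K)))"
  using assms(3)
proof (induction m arbitrary: v)
  case 0
  then show ?case by (auto intro: reaches_refl)
next
  case (Suc m)
  then obtain i where i: "rec_nat (Some r) F m = Some i" and v: "run A q \<llangle>x, \<llangle>m, i\<rrangle>\<rrangle> = Some v"
    by (auto simp: F_def split: bind_splits)
  obtain N1 where N1: "\<And>z j K. \<lbrakk>agrees z A; p2 z \<ge> N1\<rbrakk> \<Longrightarrow>
      reaches z (return_state r (push 3 (prog_encode q) \<llangle>x, \<llangle>0, m + j\<rrangle>\<rrangle> K))
              (return_state i (push 3 (prog_encode q) \<llangle>x, \<llangle>m, j\<rrangle>\<rrangle> K))"
    using Suc.IH[OF i] by blast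
  obtain N2 where N2: "\<And>z K. \<lbrakk>agrees z A; p2 z \<ge> N2\<rbrakk> \<Longrightarrow>
      reaches z (eval_state (prog_encode q) \<llangle>x, \<llangle>m, i\<rrangle>\<rrangle> K) (return_state v K)"
    using assms(1)[OF v] unfolding evaluates_def by blast
  show ?case
  proof (intro exI[of _ "max N1 N2"] allI impI)
    fix z j K assume "agrees z A \<and> max N1 N2 \<le> p2 z"
    then show "reaches z (return_state r (push 3 (prog_encode q) \<llangle>x, \<llangle>0, Suc m + j\<rrangle>\<rrangle> K))
               (return_state v (push 3 (prog_encode q) \<llangle>x, \<llangle>Suc m, j\<rrangle>\<rrangle> K))"
      using N1[of z "Suc j" K] N2[of z "push 3 (prog_encode q) \<llangle>x, \<llangle>Suc m, j\<rrangle>\<rrangle> K"]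
      by - (rule reaches_trans[OF N1[of z "Suc j" K, unfolded add_Suc_right, folded add_Suc] reaches_step],
        simp_all only: step_return max.bounded_iff)
  qed
qed

text \<open>Induction on the distance \<open>j\<close> from the current candidate to the zero, with
  the candidate \<open>m\<close> varying.\<close>

lemma Mu_search_reaches:
  assumes "\<And>k v. run A p \<llangle>n, k\<rrangle> = Some v \<Longrightarrow> evaluates A p \<llangle>n, k\<rrangle> v"
    and "run A p \<llangle>n, m + j\<rrangle> = Some 0" and "\<And>k. k < m + j \<Longrightarrow> \<exists>w. run A p \<llangle>n, k\<rrangle> = Some (Suc w)"
  shows "\<exists>N. \<forall>z. agrees z A \<and> p2 z \<ge> N \<longrightarrow>
    (\<forall>K. reaches z (eval_state (prog_encode p) \<llangle>n, m\<rrangle> (push 4 (prog_encode p) \<llangle>n, m\<rrangle> K))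
                   (return_state (m + j) K))"
  using assms(2,3)
proof (induction j arbitrary: m)
  case 0
  then obtain N where N: "\<And>z K. \<lbrakk>agrees z A; p2 z \<ge> N\<rbrakk> \<Longrightarrow>
      reaches z (eval_state (prog_encode p) \<llangle>n, m\<rrangle> K) (return_state 0 K)"
    using assms(1)[of m 0] unfolding evaluates_def by auto
  show ?case
  proof (intro exI[of _ N] allI impI)
    fix z K assume "agrees z A \<and> N \<le> p2 z"
    then show "reaches z (eval_state (prog_encode p) \<llangle>n, m\<rrangle> (push 4 (prog_encode p) \<llangle>n, m\<rrangle> K))
                   (return_state (m + 0) K)"
      by - (rule reaches_trans[OF N reaches_step], simp_all only: step_return reaches_refl add_0_right)
  qed
next
  case (Suc j)
  from Suc.prems(2)[of m] obtain w where "run A p \<llangle>n, m\<rrangle> = Some (Suc w)" by auto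
  then obtain N1 where N1: "\<And>z K. \<lbrakk>agrees z A; p2 z \<ge> N1\<rbrakk> \<Longrightarrow>
      reaches z (eval_state (prog_encode p) \<llangle>n, m\<rrangle> K) (return_state (Suc w) K)"
    using assms(1)[of m] unfolding evaluates_def by blast
  obtain N2 where N2: "\<And>z K. \<lbrakk>agrees z A; p2 z \<ge> N2\<rbrakk> \<Longrightarrow>
      reaches z (eval_state (prog_encode p) \<llangle>n, Suc m\<rrangle> (push 4 (prog_encode p) \<llangle>n, Suc m\<rrangle> K))
                (return_state (Suc m + j) K)"
    using Suc.IH[of "Suc m"] Suc.prems by auto
  show ?case
  proof (intro exI[of _ "max N1 N2"] allI impI)
    fix z K assume "agrees z A \<and> max N1 N2 \<le> p2 z"
    then show "reaches z (eval_state (prog_encode p) \<llangle>n, m\<rrangle> (push 4 (prog_encode p) \<llangle>n, m\<rrangle> K))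
                   (return_state (m + Suc j) K)"
      using N2[of z K]
      by - (rule reaches_trans[OF N1 reaches_step], simp_all only: step_return max.bounded_iff add_Suc_right add_Suc)
  qed
qed

text \<open>By minimality, the defined values below the least zero are nonzero. The successor form
  matches the branching of the machine.\<close>

lemma run_Mu_eq_Some:
  "run A (Mu p) n = Some m \<longleftrightarrow>
    run A p \<llangle>n, m\<rrangle> = Some 0 \<and> (\<forall>k<m. \<exists>w. run A p \<llangle>n, k\<rrangle> = Some (Suc w))"
proof -
  define H where "H m \<longleftrightarrow> run A p \<llangle>n, m\<rrangle> = Some 0 \<and> (\<forall>k<m. run A p \<llangle>n, k\<rrangle> \<noteq> None)" for m
  have run: "run A (Mu p) n = (if \<exists>m. H m then Some (LEAST m. H m) else None)"
    by (simp add: H_def Let_def)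
  show ?thesis
  proof
    assume "run A (Mu p) n = Some m"
    then have ex: "\<exists>m. H m" and m: "m = (LEAST m. H m)" unfolding run by (auto split: if_splits)
    have Hm: "H m" using ex unfolding m by (rule LeastI_ex)
    have "\<exists>w. run A p \<llangle>n, k\<rrangle> = Some (Suc w)" if k: "k < m" for k
    proof -
      obtain v where v: "run A p \<llangle>n, k\<rrangle> = Some v" using Hm k unfolding H_def by blast
      have "\<not> H k" using k not_less_Least[of k H] unfolding m by blast
      moreover have "\<forall>j<k. run A p \<llangle>n, j\<rrangle> \<noteq> None" using Hm k unfolding H_def by (meson order_less_trans)
      ultimately have "v \<noteq> 0" using v unfolding H_def by auto
      then show ?thesis using v by (cases v) auto
    qed
    with Hm show "run A p \<llangle>n, m\<rrangle> = Some 0 \<and> (\<forall>k<m. \<exists>w. run A p \<llangle>n, k\<rrangle> = Some (Suc w))"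
      unfolding H_def by blast
  next
    assume R: "run A p \<llangle>n, m\<rrangle> = Some 0 \<and> (\<forall>k<m. \<exists>w. run A p \<llangle>n, k\<rrangle> = Some (Suc w))"
    then have "H m" unfolding H_def by auto
    moreover have "m \<le> k" if "H k" for k
      using R that unfolding H_def by (metis Zero_not_Suc linorder_not_less option.inject)
    ultimately have "(LEAST m. H m) = m" by (rule Least_equality)
    then show "run A (Mu p) n = Some m" using \<open>H m\<close> unfolding run by auto
  qed
qed

lemma evaluates_step_eval:
  assumes "\<And>z K. step z (eval_state (prog_encode p) n K) = return_state v K"
  shows "evaluates A p n v"
  unfolding evaluates_def
  by (intro exI allI impI) (rule reaches_step, simp only: assms reaches_refl)

lemma machine_complete: "run A p n = Some v \<Longrightarrow> evaluates A p n v"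
proof (induction p arbitrary: n v)
  case Zero
  then show ?case by (simp only: evaluates_step_eval run.simps option.inject step_eval)
next
  case Succ
  then show ?case by (simp only: evaluates_step_eval run.simps option.inject step_eval)
next
  case First
  then show ?case by (simp only: evaluates_step_eval run.simps option.inject step_eval)
next
  case Second
  then show ?case by (simp only: evaluates_step_eval run.simps option.inject step_eval)
next
  case Query
  show ?case unfolding evaluates_def
  \<comment> \<open>The query at \<open>n\<close> is answered once the oracle has length greater
    than \<open>n\<close>.\<close>
  proof (intro exI[of _ "Suc n"] allI impI)
    fix z K assume "agrees z A \<and> Suc n \<le> p2 z"
    then show "reaches z (eval_state (prog_encode Query) n K) (return_state v K)"
      using Query
      by - (rule reaches_step, auto simp del: prog_encode.simps simp: step_eval reaches_refl agrees_def)
  qed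
next
  case (Tup p q)
  then obtain x y where xy: "run A p n = Some x" "run A q n = Some y" and v: "v = \<llangle>x, y\<rrangle>"
    by (auto split: bind_splits)
  obtain N1 where N1: "\<And>z K. \<lbrakk>agrees z A; p2 z \<ge> N1\<rbrakk> \<Longrightarrow>
      reaches z (eval_state (prog_encode p) n K) (return_state x K)"
    using Tup.IH(1)[OF xy(1)] unfolding evaluates_def by blast
  obtain N2 where N2: "\<And>z K. \<lbrakk>agrees z A; p2 z \<ge> N2\<rbrakk> \<Longrightarrow>
      reaches z (eval_state (prog_encode q) n K) (return_state y K)"
    using Tup.IH(2)[OF xy(2)] unfolding evaluates_def by blast
  show ?case unfolding evaluates_def
  proof (intro exI[of _ "max N1 N2"] allI impI)
    fix z K assume z: "agrees z A \<and> max N1 N2 \<le> p2 z"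
    have "reaches z (eval_state (prog_encode q) n (push 2 x 0 K)) (return_state v K)"
      using z by - (rule reaches_trans[OF N2 reaches_step], simp_all only: step_return v reaches_refl max.bounded_iff)
    then have "reaches z (eval_state (prog_encode p) n (push 1 (prog_encode q) n K)) (return_state v K)"
      using z by - (rule reaches_trans[OF N1 reaches_step], simp_all only: step_return max.bounded_iff)
    then show "reaches z (eval_state (prog_encode (Tup p q)) n K) (return_state v K)"
      by - (rule reaches_step, simp only: step_eval)
  qed
next
  case (Comp p q)
  then obtain x where x: "run A q n = Some x" and v: "run A p x = Some v"
    by (auto split: bind_splits)
  obtain N1 where N1: "\<And>z K. \<lbrakk>agrees z A; p2 z \<ge> N1\<rbrakk> \<Longrightarrow>
      reaches z (eval_state (prog_encode q) n K) (return_state x K)"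
    using Comp.IH(2)[OF x] unfolding evaluates_def by blast
  obtain N2 where N2: "\<And>z K. \<lbrakk>agrees z A; p2 z \<ge> N2\<rbrakk> \<Longrightarrow>
      reaches z (eval_state (prog_encode p) x K) (return_state v K)"
    using Comp.IH(1)[OF v] unfolding evaluates_def by blast
  show ?case unfolding evaluates_def
  proof (intro exI[of _ "max N1 N2"] allI impI)
    fix z K assume z: "agrees z A \<and> max N1 N2 \<le> p2 z"
    then have "reaches z (eval_state (prog_encode q) n (push 0 (prog_encode p) 0 K)) (return_state v K)"
      using N2[of z K] by - (rule reaches_trans[OF N1 reaches_step], simp_all only: step_return max.bounded_iff)
    then show "reaches z (eval_state (prog_encode (Comp p q)) n K) (return_state v K)"
      by - (rule reaches_step, simp only: step_eval)
  qed
next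
  case (PrimRec p q)
  define x m where "x = p1 n" and "m = p2 n"
  define F where "F = (\<lambda>k r. Option.bind r (\<lambda>i. run A q \<llangle>x, \<llangle>k, i\<rrangle>\<rrangle>))"
  have rec: "rec_nat (run A p x) F m = Some v"
    using PrimRec.prems by (simp add: F_def x_def m_def case_prod_beta)
  \<comment> \<open>Divergence at the base propagates through all rounds, so \<open>p\<close>
    converges at \<open>x\<close>.\<close>
  have "rec_nat None F j = None" for j by (induction j) (simp_all add: F_def)
  then obtain r where r: "run A p x = Some r" using rec by (cases "run A p x") auto
  obtain N1 where N1: "\<And>z K. \<lbrakk>agrees z A; p2 z \<ge> N1\<rbrakk> \<Longrightarrow>
      reaches z (eval_state (prog_encode p) x K) (return_state r K)"
    using PrimRec.IH(1)[OF r] unfolding evaluates_def by blast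
  obtain N2 where N2: "\<And>z j K. \<lbrakk>agrees z A; p2 z \<ge> N2\<rbrakk> \<Longrightarrow>
      reaches z (return_state r (push 3 (prog_encode q) \<llangle>x, \<llangle>0, m + j\<rrangle>\<rrangle> K))
                (return_state v (push 3 (prog_encode q) \<llangle>x, \<llangle>m, j\<rrangle>\<rrangle> K))"
    using PrimRec_loop_reaches[OF PrimRec.IH(2) rec[unfolded r F_def]] by blast
  show ?case unfolding evaluates_def
  proof (intro exI[of _ "max N1 N2"] allI impI)
    fix z K assume z: "agrees z A \<and> max N1 N2 \<le> p2 z"
    have "reaches z (return_state r (push 3 (prog_encode q) \<llangle>x, \<llangle>0, m + 0\<rrangle>\<rrangle> K)) (return_state v K)"
      using z by - (rule reaches_trans[OF N2 reaches_step], simp_all only: step_return reaches_refl max.bounded_iff)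
    then have "reaches z (eval_state (prog_encode p) x (push 3 (prog_encode q) \<llangle>x, \<llangle>0, m\<rrangle>\<rrangle> K)) (return_state v K)"
      using z by - (rule reaches_trans[OF N1], simp_all only: step_return max.bounded_iff add_0_right)
    then show "reaches z (eval_state (prog_encode (PrimRec p q)) n K) (return_state v K)"
      by - (rule reaches_step, simp only: step_eval x_def m_def)
  qed
next
  case (Mu p)
  obtain N where N: "\<And>z K. \<lbrakk>agrees z A; p2 z \<ge> N\<rbrakk> \<Longrightarrow>
      reaches z (eval_state (prog_encode p) \<llangle>n, 0\<rrangle> (push 4 (prog_encode p) \<llangle>n, 0\<rrangle> K)) (return_state v K)"
    using Mu_search_reaches[of A p n 0 v, OF Mu.IH] Mu.prems[unfolded run_Mu_eq_Some] unfolding add_0 by blast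
  then show ?case unfolding evaluates_def
    by (intro exI[of _ N] allI impI) (rule reaches_step, simp only: step_eval)
qed

text \<open>
  Soundness tracks the number of steps so that the unbounded search of \<open>Mu\<close> is an induction
  on the length of the computation.
\<close>

definition halts_in :: "nat \<Rightarrow> nat \<Rightarrow> nat \<Rightarrow> nat \<Rightarrow> bool" where
  "halts_in z s st v \<longleftrightarrow> (step z ^^ s) st = return_state v 0"

lemma halts_in_step:
  assumes "halts_in z s st v" and "step z st = st'" and "st \<noteq> return_state v 0"
  obtains s' where "s' < s" "halts_in z s' st' v"
proof (cases s)
  case 0
  then show ?thesis using assms by (simp add: halts_in_def)
next
  case (Suc s')
  then show ?thesis using assms that[of s'] by (simp add: halts_in_def funpow_swap1)
qed

text \<open>A run halts only on the empty stack, so a halting evaluation above any \<open>K\<close>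
  must first hand a value back to \<open>K\<close>; the claim is that this value is the right
  one.\<close>

definition machine_sound :: "nat \<Rightarrow> nat set \<Rightarrow> prog \<Rightarrow> bool" where
  "machine_sound z A p \<longleftrightarrow> (\<forall>s n K v. halts_in z s (eval_state (prog_encode p) n K) v \<longrightarrow>
     (\<exists>w s'. s' < s \<and> run A p n = Some w \<and> halts_in z s' (return_state w K) v))"

lemma machine_soundE:
  assumes "machine_sound z A p" and "halts_in z s (eval_state (prog_encode p) n K) v"
  obtains w s' where "s' < s" "run A p n = Some w" "halts_in z s' (return_state w K) v"
  using assms unfolding machine_sound_def by blast

lemma PrimRec_loop_sound:
  assumes q: "machine_sound z A q"
  defines "F \<equiv> \<lambda>x k r. Option.bind r (\<lambda>i. run A q \<llangle>x, \<llangle>k, i\<rrangle>\<rrangle>)"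
  shows "\<lbrakk>rec_nat r0 (F x) k = Some r;
      halts_in z s (return_state r (push 3 (prog_encode q) \<llangle>x, \<llangle>k, j\<rrangle>\<rrangle> K)) v\<rbrakk> \<Longrightarrow>
    \<exists>w s'. s' < s \<and> rec_nat r0 (F x) (k + j) = Some w \<and> halts_in z s' (return_state w K) v"
proof (induction j arbitrary: k r s)
  case 0
  from 0(2) obtain s' where "s' < s" "halts_in z s' (return_state r K) v"
    by (rule halts_in_step[OF _ step_return(5)]) simp
  then show ?case using 0(1) by auto
next
  case (Suc j)
  from Suc.prems(2) obtain s1 where s1: "s1 < s"
      "halts_in z s1 (eval_state (prog_encode q) \<llangle>x, \<llangle>k, r\<rrangle>\<rrangle> (push 3 (prog_encode q) \<llangle>x, \<llangle>Suc k, j\<rrangle>\<rrangle> K)) v"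
    by (rule halts_in_step[OF _ step_return(6)]) simp
  obtain w s2 where w: "s2 < s1" "run A q \<llangle>x, \<llangle>k, r\<rrangle>\<rrangle> = Some w"
      "halts_in z s2 (return_state w (push 3 (prog_encode q) \<llangle>x, \<llangle>Suc k, j\<rrangle>\<rrangle> K)) v"
    by (rule machine_soundE[OF q s1(2)])
  have "rec_nat r0 (F x) (Suc k) = Some w" using Suc.prems(1) w(2) by (simp add: F_def)
  from Suc.IH[OF this w(3)] obtain w' s3 where "s3 < s2" "rec_nat r0 (F x) (Suc k + j) = Some w'"
      "halts_in z s3 (return_state w' K) v" by blast
  then show ?case using w(1) s1(1) by (intro exI[of _ w'] exI[of _ s3]) simp
qed

lemma Mu_search_sound:
  assumes p: "machine_sound z A p"
  shows "\<lbrakk>halts_in z s (eval_state (prog_encode p) \<llangle>n, m\<rrangle> (push 4 (prog_encode p) \<llangle>n, m\<rrangle> K)) v;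
      \<forall>k<m. \<exists>w. run A p \<llangle>n, k\<rrangle> = Some (Suc w)\<rbrakk> \<Longrightarrow>
    \<exists>w s'. s' < s \<and> run A (Mu p) n = Some w \<and> halts_in z s' (return_state w K) v"
proof (induction s arbitrary: m rule: less_induct)
  case (less s)
  from less.prems(1) obtain w s1 where w: "s1 < s" "run A p \<llangle>n, m\<rrangle> = Some w"
      "halts_in z s1 (return_state w (push 4 (prog_encode p) \<llangle>n, m\<rrangle> K)) v"
    by (rule machine_soundE[OF p])
  show ?case
  proof (cases w)
    case 0
    from w(3)[unfolded 0] obtain s2 where s2: "s2 < s1" "halts_in z s2 (return_state m K) v"
      by (rule halts_in_step[OF _ step_return(7)]) simp
    have "run A (Mu p) n = Some m" using less.prems(2) w(2) 0 unfolding run_Mu_eq_Some by blast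
    then show ?thesis using w(1) s2 by (intro exI[of _ m] exI[of _ s2]) simp
  next
    case (Suc w')
    from w(3)[unfolded Suc] obtain s2 where s2: "s2 < s1"
        "halts_in z s2 (eval_state (prog_encode p) \<llangle>n, Suc m\<rrangle> (push 4 (prog_encode p) \<llangle>n, Suc m\<rrangle> K)) v"
      by (rule halts_in_step[OF _ step_return(8)]) simp
    have "\<forall>k<Suc m. \<exists>w. run A p \<llangle>n, k\<rrangle> = Some (Suc w)"
      using less.prems(2) w(2) Suc by (simp add: less_Suc_eq)
    from less.IH[OF _ s2(2) this] w(1) s2(1) obtain u s3 where "s3 < s2" "run A (Mu p) n = Some u"
        "halts_in z s3 (return_state u K) v" by (meson order_less_trans)
    then show ?thesis using w(1) s2(1) by (intro exI[of _ u] exI[of _ s3]) simp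
  qed
qed

lemma machine_sound_step_eval:
  assumes "\<And>n K. step z (eval_state (prog_encode p) n K) = return_state (f n) K"
    and "\<And>n. run A p n = Some (f n)"
  shows "machine_sound z A p"
  unfolding machine_sound_def
proof (intro allI impI)
  fix s n K v assume "halts_in z s (eval_state (prog_encode p) n K) v"
  then obtain s' where "s' < s" "halts_in z s' (return_state (f n) K) v"
    by (rule halts_in_step[OF _ assms(1)]) simp
  then show "\<exists>w s'. s' < s \<and> run A p n = Some w \<and> halts_in z s' (return_state w K) v"
    using assms(2) by (intro exI[of _ "f n"] exI[of _ s']) simp
qed

lemma machine_sound:
  assumes z: "agrees z A"
  shows "machine_sound z A p"
proof (induction p)
  case Query
  have "\<exists>w s'. s' < s \<and> run A Query n = Some w \<and> halts_in z s' (return_state w K) v"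
    if "halts_in z s (eval_state (prog_encode Query) n K) v" for s n K v
    using that
  \<comment> \<open>A query beyond the length of the oracle leaves the state unchanged, and
    induction on the number of steps shows that such a run never halts.\<close>
  proof (induction s)
    case 0
    then show ?case by (simp add: halts_in_def)
  next
    case (Suc s)
    then have h: "halts_in z s (step z (eval_state (prog_encode Query) n K)) v"
      by (simp add: halts_in_def funpow_swap1 del: prog_encode.simps)
    show ?case
    proof (cases "n < p2 z")
      case True
      have "halts_in z s (return_state (if n \<in> A then 1 else 0) K) v"
        using h z True by (simp add: step_eval(5) agrees_def del: prog_encode.simps)
      then show ?thesis by auto
    next
      case False
      then have "halts_in z s (eval_state (prog_encode Query) n K) v"
        using h by (simp add: step_eval(5) del: prog_encode.simps)
      then show ?thesis using Suc.IH less_SucI by blast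
    qed
  qed
  then show ?case unfolding machine_sound_def by blast
next
  case (Tup p q)
  show ?case unfolding machine_sound_def
  proof (intro allI impI)
    fix s n K v assume "halts_in z s (eval_state (prog_encode (Tup p q)) n K) v"
    then obtain s1 where s1: "s1 < s" "halts_in z s1 (eval_state (prog_encode p) n (push 1 (prog_encode q) n K)) v"
      by (rule halts_in_step[OF _ step_eval(6)]) simp
    obtain x s2 where x: "s2 < s1" "run A p n = Some x" "halts_in z s2 (return_state x (push 1 (prog_encode q) n K)) v"
      by (rule machine_soundE[OF Tup.IH(1) s1(2)])
    from x(3) obtain s3 where s3: "s3 < s2" "halts_in z s3 (eval_state (prog_encode q) n (push 2 x 0 K)) v"
      by (rule halts_in_step[OF _ step_return(3)]) simp
    obtain y s4 where y: "s4 < s3" "run A q n = Some y" "halts_in z s4 (return_state y (push 2 x 0 K)) v"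
      by (rule machine_soundE[OF Tup.IH(2) s3(2)])
    from y(3) obtain s5 where s5: "s5 < s4" "halts_in z s5 (return_state \<llangle>x, y\<rrangle> K) v"
      by (rule halts_in_step[OF _ step_return(4)]) simp
    have "s5 < s" using s1(1) x(1) s3(1) y(1) s5(1) by simp
    then show "\<exists>w s'. s' < s \<and> run A (Tup p q) n = Some w \<and> halts_in z s' (return_state w K) v"
      using x(2) y(2) s5(2) by auto
  qed
next
  case (Comp p q)
  show ?case unfolding machine_sound_def
  proof (intro allI impI)
    fix s n K v assume "halts_in z s (eval_state (prog_encode (Comp p q)) n K) v"
    then obtain s1 where s1: "s1 < s" "halts_in z s1 (eval_state (prog_encode q) n (push 0 (prog_encode p) 0 K)) v"
      by (rule halts_in_step[OF _ step_eval(7)]) simp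
    obtain x s2 where x: "s2 < s1" "run A q n = Some x" "halts_in z s2 (return_state x (push 0 (prog_encode p) 0 K)) v"
      by (rule machine_soundE[OF Comp.IH(2) s1(2)])
    from x(3) obtain s3 where s3: "s3 < s2" "halts_in z s3 (eval_state (prog_encode p) x K) v"
      by (rule halts_in_step[OF _ step_return(2)]) simp
    obtain y s4 where y: "s4 < s3" "run A p x = Some y" "halts_in z s4 (return_state y K) v"
      by (rule machine_soundE[OF Comp.IH(1) s3(2)])
    have "s4 < s" using s1(1) x(1) s3(1) y(1) by simp
    then show "\<exists>w s'. s' < s \<and> run A (Comp p q) n = Some w \<and> halts_in z s' (return_state w K) v"
      using x(2) y(2,3) by auto
  qed
next
  case (PrimRec p q)
  show ?case unfolding machine_sound_def
  proof (intro allI impI)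
    fix s n K v assume "halts_in z s (eval_state (prog_encode (PrimRec p q)) n K) v"
    then obtain s1 where s1: "s1 < s"
        "halts_in z s1 (eval_state (prog_encode p) (p1 n) (push 3 (prog_encode q) \<llangle>p1 n, \<llangle>0, p2 n\<rrangle>\<rrangle> K)) v"
      by (rule halts_in_step[OF _ step_eval(8)]) simp
    obtain r s2 where r: "s2 < s1" "run A p (p1 n) = Some r"
        "halts_in z s2 (return_state r (push 3 (prog_encode q) \<llangle>p1 n, \<llangle>0, p2 n\<rrangle>\<rrangle> K)) v"
      by (rule machine_soundE[OF PrimRec.IH(1) s1(2)])
    show "\<exists>w s'. s' < s \<and> run A (PrimRec p q) n = Some w \<and> halts_in z s' (return_state w K) v"
      using PrimRec_loop_sound[OF PrimRec.IH(2) _ r(3), of "run A p (p1 n)"] r(2)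
      order_less_trans[OF _ order_less_trans[OF r(1) s1(1)]] by (simp add: case_prod_beta) blast
  qed
next
  case (Mu p)
  show ?case unfolding machine_sound_def
  proof (intro allI impI)
    fix s n K v assume "halts_in z s (eval_state (prog_encode (Mu p)) n K) v"
    then obtain s1 where s1: "s1 < s"
        "halts_in z s1 (eval_state (prog_encode p) \<llangle>n, 0\<rrangle> (push 4 (prog_encode p) \<llangle>n, 0\<rrangle> K)) v"
      by (rule halts_in_step[OF _ step_eval(9)]) simp
    show "\<exists>w s'. s' < s \<and> run A (Mu p) n = Some w \<and> halts_in z s' (return_state w K) v"
      using Mu_search_sound[OF Mu.IH s1(2)] order_less_trans[OF _ s1(1)] by blast
  qed
next
  case Zero
  show ?case by (rule machine_sound_step_eval[OF step_eval(1)]) simp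
next
  case Succ
  show ?case by (rule machine_sound_step_eval[OF step_eval(2)]) simp
next
  case First
  show ?case by (rule machine_sound_step_eval[OF step_eval(3)]) simp
next
  case Second
  show ?case by (rule machine_sound_step_eval[OF step_eval(4)]) simp
qed


section \<open>Partial computable functions\<close>

text \<open>The result 0 means "not finished after \<open>s\<close> steps"; a finished run with
  value \<open>v\<close> is reported as \<open>Suc v\<close>.\<close>

definition outcome :: "nat \<Rightarrow> nat \<Rightarrow> nat \<Rightarrow> nat \<Rightarrow> nat" where
  "outcome z s e n = (let st = (step z ^^ s) (eval_state e n 0)
     in if p1 st = 0 \<and> p1 (p2 st) = 0 then Suc (p2 (p2 st)) else 0)"

lemma outcome_eq_Suc: "outcome z s e n = Suc v \<longleftrightarrow> halts_in z s (eval_state e n 0) v"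
proof -
  obtain K x w where "(step z ^^ s) (eval_state e n 0) = \<llangle>K, \<llangle>x, w\<rrangle>\<rrangle>"
    by (metis prod_decode_inverse surj_pair)
  then show ?thesis unfolding outcome_def halts_in_def Let_def by (auto simp: prod_encode_eq)
qed

lemma computable_outcome:
  assumes "computable z" "computable s" "computable e" "computable n"
  shows "computable (\<lambda>x. outcome (z x) (s x) (e x) (n x))"
  unfolding outcome_def Let_def
  by (intro computable_step_funpow computable_intros assms)

lemma halts_in_return_state: "halts_in z s (return_state w 0) v \<Longrightarrow> w = v"
proof -
  have "(step z ^^ s) (return_state w 0) = return_state w 0"
    by (induction s) (simp_all add: step_return(1))
  then show "halts_in z s (return_state w 0) v \<Longrightarrow> w = v" by (simp add: halts_in_def)
qed

lemma agrees_exists: "\<exists>z. agrees z A \<and> p2 z = N"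
proof
  have "set_decode (set_encode (A \<inter> {..<N})) = A \<inter> {..<N}" by (simp add: set_encode_inverse)
  then show "agrees \<llangle>set_encode (A \<inter> {..<N}), N\<rrangle> A \<and> p2 \<llangle>set_encode (A \<inter> {..<N}), N\<rrangle> = N"
    by (auto simp: agrees_def)
qed

lemma outcome_sound:
  assumes "agrees z A" "outcome z s e n = Suc v" shows "phi_rel A e n = Some v"
proof -
  have "halts_in z s (eval_state (prog_encode (prog_decode e)) n 0) v"
    using assms(2) by (simp add: outcome_eq_Suc)
  then obtain w s' where "phi_rel A e n = Some w" "halts_in z s' (return_state w 0) v"
    unfolding phi_rel_def by (rule machine_soundE[OF machine_sound[OF assms(1)]])
  then show ?thesis using halts_in_return_state by auto
qed

lemma outcome_complete:
  assumes "phi_rel A e n = Some v"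
  shows "\<exists>N. \<forall>z. agrees z A \<and> p2 z \<ge> N \<longrightarrow> (\<exists>s. outcome z s e n = Suc v)"
  using machine_complete[OF assms[unfolded phi_rel_def]]
  unfolding evaluates_def reaches_def outcome_eq_Suc halts_in_def prog_encode_decode by blast

text \<open>Convergence becomes a search over finite oracles and step counts in which only
  \<open>agrees z A\<close> mentions \<open>A\<close>. This is the form in which the Turing jump is
  coded later.\<close>

lemma phi_rel_dom_iff:
  "phi_rel A e n \<noteq> None \<longleftrightarrow> (\<exists>z s. agrees z A \<and> outcome z s e n \<noteq> 0)"
proof
  assume "phi_rel A e n \<noteq> None"
  then obtain v where "phi_rel A e n = Some v" by blast
  then obtain N where N: "\<And>z. agrees z A \<and> p2 z \<ge> N \<Longrightarrow> \<exists>s. outcome z s e n = Suc v"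
    using outcome_complete by blast
  obtain z where "agrees z A \<and> p2 z = N" using agrees_exists by blast
  then show "\<exists>z s. agrees z A \<and> outcome z s e n \<noteq> 0" using N[of z] by (metis Zero_not_Suc order_refl)
next
  assume "\<exists>z s. agrees z A \<and> outcome z s e n \<noteq> 0"
  then show "phi_rel A e n \<noteq> None" using outcome_sound by (metis not0_implies_Suc option.distinct(1))
qed

text \<open>The stage \<open>w\<close> pairs the length of an all-zero oracle with a number of
  steps; zeros are the correct answers for the empty set.\<close>

definition phi_stage :: "nat \<Rightarrow> nat \<Rightarrow> nat \<Rightarrow> nat" where
  "phi_stage e n w = outcome \<llangle>0, p1 w\<rrangle> (p2 w) e n"

lemma computable_phi_stage:
  assumes "computable e" "computable n" "computable w"
  shows "computable (\<lambda>x. phi_stage (e x) (n x) (w x))"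
  unfolding phi_stage_def by (intro computable_outcome computable_intros assms)

lemma agrees_empty: "agrees \<llangle>0, t\<rrangle> {}"
  by (simp add: agrees_def set_decode_def)

lemma phi_eq_Some_iff: "phi e n = Some v \<longleftrightarrow> (\<exists>w. phi_stage e n w = Suc v)"
proof
  assume "phi e n = Some v"
  then obtain N where N: "\<And>z. agrees z {} \<and> p2 z \<ge> N \<Longrightarrow> \<exists>s. outcome z s e n = Suc v"
    using outcome_complete unfolding phi_def by blast
  obtain s where "outcome \<llangle>0, N\<rrangle> s e n = Suc v" using N[of "\<llangle>0, N\<rrangle>"] agrees_empty by auto
  then show "\<exists>w. phi_stage e n w = Suc v"
    unfolding phi_stage_def by (intro exI[of _ "\<llangle>N, s\<rrangle>"]) simp
next
  assume "\<exists>w. phi_stage e n w = Suc v"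
  then show "phi e n = Some v" unfolding phi_stage_def phi_def using outcome_sound agrees_empty by blast
qed

section \<open>Closure properties of partial computable functions\<close>

definition pcomputable :: "(nat \<Rightarrow> nat option) \<Rightarrow> bool" where
  "pcomputable f \<longleftrightarrow> (\<exists>p. run {} p = f)"

lemma pcomputable_Some: "computable f \<Longrightarrow> pcomputable (\<lambda>x. Some (f x))"
  unfolding pcomputable_def computable_iff_run by (auto simp: fun_eq_iff)

lemma pcomputable_comp:
  assumes "pcomputable f" "computable g" shows "pcomputable (\<lambda>x. f (g x))"
proof -
  obtain p q where "run {} p = f" "\<forall>n. run {} q n = Some (g n)"
    using assms unfolding pcomputable_def computable_iff_run by blast
  then show ?thesis unfolding pcomputable_def by (intro exI[of _ "Comp p q"]) auto
qed

lemma pcomputable_bind: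
  assumes "pcomputable f" "pcomputable (\<lambda>y. g (p1 y) (p2 y))"
  shows "pcomputable (\<lambda>x. Option.bind (f x) (g x))"
proof -
  obtain p q where "run {} p = f" "run {} q = (\<lambda>y. g (p1 y) (p2 y))"
    using assms unfolding pcomputable_def by blast
  then show ?thesis unfolding pcomputable_def
    by (intro exI[of _ "Comp q (Tup (Tup First Second) p)"]) (auto simp: fun_eq_iff split: bind_splits)
qed

lemma pcomputable_Least:
  assumes "decidable (\<lambda>y. P (p1 y) (p2 y))"
  shows "pcomputable (\<lambda>x. if \<exists>m. P x m then Some (LEAST m. P x m) else None)"
proof -
  have "computable (\<lambda>y. if P (p1 y) (p2 y) then 0 else 1)"
    by (intro computable_intros assms)
  then obtain p where "\<And>y. run {} p y = Some (if P (p1 y) (p2 y) then 0 else 1)"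
    unfolding computable_iff_run by blast
  then show ?thesis unfolding pcomputable_def
    by (intro exI[of _ "Mu p"]) (simp add: fun_eq_iff Let_def)
qed

lemma pcomputable_phi:
  assumes "computable f" "computable g" shows "pcomputable (\<lambda>x. phi (f x) (g x))"
proof -
  define L where "L x = (if \<exists>w. phi_stage (p1 x) (p2 x) w \<noteq> 0
    then Some (LEAST w. phi_stage (p1 x) (p2 x) w \<noteq> 0) else None)" for x
  have "pcomputable L"
    unfolding L_def by (intro pcomputable_Least computable_phi_stage computable_intros)
  then have "pcomputable (\<lambda>x. Option.bind (L x) (\<lambda>w. Some (phi_stage (p1 x) (p2 x) w - 1)))"
    by (intro pcomputable_bind pcomputable_Some computable_phi_stage computable_intros)
  moreover have "Option.bind (L x) (\<lambda>w. Some (phi_stage (p1 x) (p2 x) w - 1)) = phi (p1 x) (p2 x)" for x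
  proof (cases "\<exists>w. phi_stage (p1 x) (p2 x) w \<noteq> 0")
    case True
    define w where "w = (LEAST w. phi_stage (p1 x) (p2 x) w \<noteq> 0)"
    have "phi_stage (p1 x) (p2 x) w \<noteq> 0" using LeastI_ex[OF True] by (simp add: w_def)
    then have "phi (p1 x) (p2 x) = Some (phi_stage (p1 x) (p2 x) w - 1)"
      unfolding phi_eq_Some_iff by (intro exI[of _ w]) simp
    then show ?thesis using True by (simp add: L_def w_def)
  next
    case False
    then have "phi (p1 x) (p2 x) \<noteq> Some v" for v unfolding phi_eq_Some_iff by fastforce
    then show ?thesis using False by (simp add: L_def) (metis not_None_eq)
  qed
  ultimately have "pcomputable (\<lambda>x. phi (p1 x) (p2 x))" by simp
  from pcomputable_comp[OF this computable_pairing[OF assms]] show ?thesis by simp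
qed

text \<open>
  Only the selected branch may be evaluated, so the branches are chosen on the level of indices.
\<close>

lemma pcomputable_if:
  assumes "decidable P" "pcomputable f" "pcomputable g"
  shows "pcomputable (\<lambda>x. if P x then f x else g x)"
proof -
  obtain p q where "run {} p = f" "run {} q = g" using assms unfolding pcomputable_def by blast
  moreover have "pcomputable (\<lambda>x. phi (if P x then prog_encode p else prog_encode q) x)"
    by (intro pcomputable_phi computable_intros assms)
  ultimately show ?thesis by (simp add: if_distrib if_distribR cong: if_cong)
qed

lemmas pcomputable_intros =
  pcomputable_Some pcomputable_bind pcomputable_phi pcomputable_if

subsection \<open>Indices\<close>

primrec const_prog :: "nat \<Rightarrow> prog" where
  "const_prog 0 = Zero"
| "const_prog (Suc c) = Comp Succ (const_prog c)"

lemma run_const_prog [simp]: "run A (const_prog c) n = Some c"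
  by (induction c) simp_all

lemma computable_const_prog:
  assumes "computable f" shows "computable (\<lambda>x. prog_encode (const_prog (f x)))"
proof -
  have "prog_encode (const_prog c) = rec_nat 0 (\<lambda>k r. 4 * \<llangle>1, r\<rrangle> + 6) c" for c
    by (induction c) simp_all
  moreover have "computable (\<lambda>x. rec_nat 0 (\<lambda>k r. 4 * \<llangle>1, r\<rrangle> + 6) (f x))"
    by (intro computable_rec_nat computable_intros assms)
  ultimately show ?thesis by simp
qed

lemma s_m_n:
  assumes "pcomputable \<psi>"
  shows "\<exists>h. computable h \<and> (\<forall>x n. phi (h x) n = \<psi> \<llangle>x, n\<rrangle>)"
proof -
  obtain p where p: "run {} p = \<psi>" using assms unfolding pcomputable_def by blast
  define h where "h x = prog_encode (Comp p (Tup (const_prog x) (Tup First Second)))" for x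
  have "computable h" unfolding h_def prog_encode.simps
    by (intro computable_const_prog computable_intros)
  moreover have "phi (h x) n = \<psi> \<llangle>x, n\<rrangle>" for x n by (simp add: h_def p del: prog_encode.simps)
  ultimately show ?thesis by blast
qed

text \<open>Choosing one index function for each \<open>\<psi>\<close> lets later definitions
  mention the resulting indices as terms; \<open>range_index\<close> is chosen for the same
  reason.\<close>

definition curry_index :: "(nat \<Rightarrow> nat option) \<Rightarrow> nat \<Rightarrow> nat" where
  "curry_index \<psi> = (SOME h. computable h \<and> (\<forall>x n. phi (h x) n = \<psi> \<llangle>x, n\<rrangle>))"

lemma
  assumes "pcomputable \<psi>"
  shows computable_curry_index: "computable f \<Longrightarrow> computable (\<lambda>x. curry_index \<psi> (f x))"
    and phi_curry_index: "phi (curry_index \<psi> x) n = \<psi> \<llangle>x, n\<rrangle>"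
  using someI_ex[OF s_m_n[OF assms]] unfolding curry_index_def[symmetric]
  by (auto intro: computable_comp)

definition range_index :: "(nat \<Rightarrow> nat option) \<Rightarrow> nat \<Rightarrow> nat" where
  "range_index \<psi> = (SOME h. computable h \<and> (\<forall>x. W (h x) = {v. \<exists>s. \<psi> \<llangle>x, s\<rrangle> = Some v}))"

lemma ex_range_index:
  assumes "pcomputable \<psi>"
  shows "\<exists>h. computable h \<and> (\<forall>x. W (h x) = {v. \<exists>s. \<psi> \<llangle>x, s\<rrangle> = Some v})"
proof -
  obtain e where e: "phi e = \<psi>" using assms unfolding pcomputable_def by (metis phi_prog_encode)
  \<comment> \<open>Dovetailing: \<open>u\<close> pairs an argument with a stage, so the search for
    \<open>u\<close> halts exactly on the enumerated values, even where \<open>\<psi>\<close>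
    diverges on some arguments.\<close>
  define P where "P y u \<longleftrightarrow> phi_stage e \<llangle>p1 y, p1 u\<rrangle> (p2 u) = Suc (p2 y)" for y u
  have "pcomputable (\<lambda>y. if \<exists>u. P y u then Some (LEAST u. P y u) else None)"
    unfolding P_def by (intro pcomputable_Least computable_phi_stage computable_intros)
  from s_m_n[OF this] obtain h where h: "computable h"
    "\<And>x v. phi (h x) v = (if \<exists>u. P \<llangle>x, v\<rrangle> u then Some (LEAST u. P \<llangle>x, v\<rrangle> u) else None)"
    by blast
  have "v \<in> W (h x) \<longleftrightarrow> (\<exists>s. \<psi> \<llangle>x, s\<rrangle> = Some v)" for x v
  proof -
    have "v \<in> W (h x) \<longleftrightarrow> (\<exists>u. P \<llangle>x, v\<rrangle> u)" unfolding W_def by (simp add: dom_def h(2))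
    also have "\<dots> \<longleftrightarrow> (\<exists>s w. phi_stage e \<llangle>x, s\<rrangle> w = Suc v)"
      unfolding P_def by (metis fst_conv snd_conv prod_encode_inverse)
    finally show ?thesis by (simp add: phi_eq_Some_iff[symmetric] e)
  qed
  then show ?thesis using h(1) by blast
qed

lemma
  assumes "pcomputable \<psi>"
  shows computable_range_index: "computable f \<Longrightarrow> computable (\<lambda>x. range_index \<psi> (f x))"
    and W_range_index: "W (range_index \<psi> x) = {v. \<exists>s. \<psi> \<llangle>x, s\<rrangle> = Some v}"
  using someI_ex[OF ex_range_index[OF assms]] unfolding range_index_def[symmetric]
  by (auto intro: computable_comp)

lemma recursion_theorem:
  assumes "pcomputable q"
  obtains e where "\<And>n. phi e n = q \<llangle>e, n\<rrangle>"
proof -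
  obtain Q where Q: "run {} Q = q" using assms unfolding pcomputable_def by blast
  \<comment> \<open>\<open>d u\<close> is an index of the diagonal map sending \<open>n\<close> to
    the value of program \<open>u\<close> at \<open>\<llangle>u, n\<rrangle>\<close>.\<close>
  define d where "d u = prog_encode (Comp (prog_decode u) (Tup (const_prog u) (Tup First Second)))" for u
  have "computable d" unfolding d_def prog_encode.simps prog_encode_decode
    by (intro computable_const_prog computable_intros)
  then obtain D where D: "\<And>n. run {} D n = Some (d n)" unfolding computable_iff_run by blast
  \<comment> \<open>Program \<open>u\<close> applies \<open>d\<close> to its first argument before
    calling \<open>q\<close>; on the diagonal it therefore hands \<open>q\<close> the index
    \<open>d u\<close> itself.\<close>
  define u where "u = prog_encode (Comp Q (Tup (Comp D First) Second))"
  have "phi (d u) n = q \<llangle>d u, n\<rrangle>" for n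
  proof -
    have "phi (d u) n = run {} (Comp Q (Tup (Comp D First) Second)) \<llangle>u, n\<rrangle>"
      by (simp add: d_def del: prog_encode.simps) (simp add: u_def del: prog_encode.simps)
    then show ?thesis by (simp add: D Q)
  qed
  then show ?thesis by (rule that)
qed

text \<open>The program \<open>k n\<close> ignores its input, decides whether \<open>n\<close> is in
  \<open>X\<close> and diverges on a negative answer; so it halts on its own index iff
  \<open>n\<close> is in \<open>X\<close>.\<close>

lemma turing_le_jump_reduction:
  assumes "X \<le>\<^sub>T A"
  shows "\<exists>k. computable k \<and> (\<forall>n. n \<in> X \<longleftrightarrow> k n \<in> turing_jump A)"
proof -
  obtain e where e: "\<And>n. phi_rel A e n = Some (if n \<in> X then 1 else 0)"
    using assms unfolding turing_le_def by blast
  \<comment> \<open>The searched function is constantly 1 on input 0 and constantly 0 on positive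
    inputs, so the search diverges at 0 and stops at once at 1.\<close>
  define halt where "halt = Mu (Comp (PrimRec (const_prog 1) Zero) (Tup Zero First))"
  have "run A halt 0 = None" by (simp add: halt_def Let_def)
  moreover have "run A halt 1 \<noteq> None" by (simp add: halt_def Let_def)
  ultimately have halt: "run A halt (if P then 1 else 0) \<noteq> None \<longleftrightarrow> P" for P by simp
  define k where "k n = prog_encode (Comp halt (Comp (prog_decode e) (const_prog n)))" for n
  have "computable k" unfolding k_def prog_encode.simps
    by (intro computable_const_prog computable_intros)
  moreover have "n \<in> X \<longleftrightarrow> k n \<in> turing_jump A" for n
    using halt[of "n \<in> X"] e[of n] by (simp add: turing_jump_def phi_rel_def k_def del: prog_encode.simps)
  ultimately show ?thesis by blast
qed


section \<open>Effective recursion on notations\<close>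

text \<open>The simultaneous rule also needs a claim about \<open><\<^sub>O\<close>; carrying
  \<open>P\<close> for both ends of a comparison supplies it for the members of fundamental
  sequences.\<close>

lemma kleene_O_induct [consumes 1, case_names zero succ lim]:
  assumes "kleene_O a"
    and "P 1"
    and "\<And>b. \<lbrakk>kleene_O b; P b\<rbrakk> \<Longrightarrow> P (2 ^ b)"
    and "\<And>e f. \<lbrakk>\<And>n. phi e n = Some (f n); \<And>n. f n <\<^sub>O f (Suc n); \<And>n. P (f n)\<rbrakk> \<Longrightarrow> P (3 * 5 ^ e)"
  shows "P a"
proof -
  have "(kleene_O a \<longrightarrow> P a) \<and> (a <\<^sub>O b \<longrightarrow> P a \<and> P b)" for a b
    by (rule kleene_O_kleene_less.induct) (use assms(2-4) in auto)
  then show ?thesis using assms(1) by blast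
qed

definition log2 :: "nat \<Rightarrow> nat" where
  "log2 a = (\<Sum>i<a. if 2 ^ i = a then i else 0)"

definition lim_index :: "nat \<Rightarrow> nat" where
  "lim_index a = (\<Sum>i<a. if 3 * 5 ^ i = a then i else 0)"

lemma log2_power [simp]: "log2 (2 ^ c) = c"
  unfolding log2_def by (subst sum_delta_below[where k = c]) simp_all

lemma lim_index_power [simp]: "lim_index (3 * 5 ^ e) = e"
proof -
  have "e < 5 ^ e" by (induction e) auto
  then show ?thesis unfolding lim_index_def by (subst sum_delta_below[where k = e]) simp_all
qed

text \<open>Divisibility by 3 hence separates limit notations from successor notations
  computably.\<close>

lemma power_two_mod_three: "(2::nat) ^ c mod 3 \<noteq> 0"
proof (induction c)
  case (Suc c)
  have "(2 * m) mod 3 \<noteq> 0" if "m mod 3 \<noteq> 0" for m :: nat using that by presburger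
  from this[OF Suc] show ?case by simp
qed simp

lemma kleene_O_power_neq_one: "kleene_O c \<Longrightarrow> 2 ^ c \<noteq> (1::nat)"
  using not_kleene_O_0 by (cases c) auto

lemma computable_log2: "computable f \<Longrightarrow> computable (\<lambda>x. log2 (f x))"
  unfolding log2_def by (intro computable_sum computable_intros) (rule computable_comp, assumption, intro computable_intros)+

lemma computable_lim_index: "computable f \<Longrightarrow> computable (\<lambda>x. lim_index (f x))"
  unfolding lim_index_def by (intro computable_sum computable_intros) (rule computable_comp, assumption, intro computable_intros)+

text \<open>\<open>b\<close> assigns to a notation the level at which its \<open>H\<close>-set will
  be coded: three jumps for each successor, two on top of each limit. Monotonicity makes the images
  of fundamental sequences fundamental again.\<close>

lemma notation_map:
  obtains b :: "nat \<Rightarrow> nat" where "b 1 = 1" and "\<And>a. kleene_O a \<Longrightarrow> b (2 ^ a) = 2 ^ 2 ^ 2 ^ b a"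
    and "\<And>e f. \<lbrakk>\<And>n. phi e n = Some (f n); \<And>n. f n <\<^sub>O f (Suc n)\<rbrakk> \<Longrightarrow>
      \<exists>e'. b (3 * 5 ^ e) = 2 ^ 2 ^ (3 * 5 ^ e') \<and> (\<forall>n. phi e' n = Some (b (f n)))"
    and "\<And>x y. x <\<^sub>O y \<Longrightarrow> b x <\<^sub>O b y"
proof -
  \<comment> \<open>On \<open>\<llangle>\<llangle>B, e\<rrangle>, n\<rrangle>\<close> this is
    program \<open>B\<close> after program \<open>e\<close>. Its curried index serves as the new
    fundamental sequence, so no value of \<open>B\<close> is needed at a limit.\<close>
  define \<beta> where "\<beta> y = Option.bind (phi (p2 (p1 y)) (p2 y)) (phi (p1 (p1 y)))" for y
  have \<beta>: "pcomputable \<beta>" unfolding \<beta>_def[abs_def] by (intro pcomputable_intros computable_intros)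
  define q where "q y =
    (if p2 y = 1 then Some (1 :: nat)
     else if p2 y mod 3 = 0 then Some (2 ^ 2 ^ (3 * 5 ^ curry_index \<beta> \<llangle>p1 y, lim_index (p2 y)\<rrangle>))
     else Option.bind (phi (p1 y) (log2 (p2 y))) (\<lambda>v. Some (2 ^ 2 ^ 2 ^ v)))" for y
  have "pcomputable q" unfolding q_def[abs_def]
    by (intro pcomputable_intros computable_intros computable_curry_index[OF \<beta>] computable_lim_index computable_log2)
  then obtain B where B: "\<And>n. phi B n = q \<llangle>B, n\<rrangle>" by (rule recursion_theorem) blast
  have B1: "phi B 1 = Some 1" using B[of 1] by (simp add: q_def)
  have B2: "phi B (2 ^ c) = Option.bind (phi B c) (\<lambda>v. Some (2 ^ 2 ^ 2 ^ v))" if "kleene_O c" for c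
    unfolding B[of "2 ^ c"] using power_two_mod_three[of c] kleene_O_power_neq_one[OF that] by (simp add: q_def)
  have B3: "phi B (3 * 5 ^ e) = Some (2 ^ 2 ^ (3 * 5 ^ curry_index \<beta> \<llangle>B, e\<rrangle>))" for e
    unfolding B[of "3 * 5 ^ e"] by (simp add: q_def)
  define b where "b a = the (phi B a)" for a
  have lim: "phi (curry_index \<beta> \<llangle>B, e\<rrangle>) n = phi B m" if "phi e n = Some m" for e n m
    using that by (simp add: phi_curry_index[OF \<beta>] \<beta>_def)
  have less3: "x <\<^sub>O 2 ^ 2 ^ 2 ^ x" "kleene_O (2 ^ 2 ^ 2 ^ x)" if "kleene_O x" for x
    using that by (blast intro: kleene_O_kleene_less.intros)+
  have less2: "x <\<^sub>O 2 ^ 2 ^ y" if "x <\<^sub>O y" for x y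
    using that kleene_less_O by (blast intro: kleene_O_kleene_less.intros)
  \<comment> \<open>Convergence, membership in the notations and preservation of the order are
    proved together, since the limit case of each needs the others.\<close>
  have main: "(kleene_O x \<longrightarrow> phi B x = Some (b x) \<and> kleene_O (b x)) \<and>
      (x <\<^sub>O y \<longrightarrow> phi B x = Some (b x) \<and> phi B y = Some (b y) \<and> b x <\<^sub>O b y)" for x y
  proof (rule kleene_O_kleene_less.induct)
    show "phi B 1 = Some (b 1) \<and> kleene_O (b 1)" using B1 by (auto simp: b_def intro: O_zero[unfolded One_nat_def])
  next
    fix c assume "kleene_O c" and c: "phi B c = Some (b c) \<and> kleene_O (b c)"
    then have "phi B (2 ^ c) = Some (2 ^ 2 ^ 2 ^ b c)" using B2 by simp
    moreover from this have "b (2 ^ c) = 2 ^ 2 ^ 2 ^ b c" by (simp add: b_def)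
    ultimately show "phi B (2 ^ c) = Some (b (2 ^ c)) \<and> kleene_O (b (2 ^ c))"
      and "phi B c = Some (b c) \<and> phi B (2 ^ c) = Some (b (2 ^ c)) \<and> b c <\<^sub>O b (2 ^ c)"
      using c less3[of "b c"] by auto
  next
    fix e f assume f: "\<And>n. phi e n = Some (f n)" "\<And>n. f n <\<^sub>O f (Suc n)"
      and IH: "\<And>n. phi B (f n) = Some (b (f n)) \<and> phi B (f (Suc n)) = Some (b (f (Suc n))) \<and> b (f n) <\<^sub>O b (f (Suc n))"
    define e' where "e' = curry_index \<beta> \<llangle>B, e\<rrangle>"
    have e': "phi e' n = Some (b (f n))" for n using lim[OF f(1)] IH unfolding e'_def by simp
    have b: "b (3 * 5 ^ e) = 2 ^ 2 ^ (3 * 5 ^ e')" "phi B (3 * 5 ^ e) = Some (b (3 * 5 ^ e))"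
      using B3 by (simp_all add: b_def e'_def)
    have IH': "b (f n) <\<^sub>O b (f (Suc n))" for n using IH by blast
    have O': "b (f k) <\<^sub>O 3 * 5 ^ e'" for k using e' IH' by (rule less_lim)
    show "phi B (3 * 5 ^ e) = Some (b (3 * 5 ^ e)) \<and> kleene_O (b (3 * 5 ^ e))"
      using b O_succ[OF O_succ[OF O_lim[OF e' IH']]] by simp
    show "phi B (f k) = Some (b (f k)) \<and> phi B (3 * 5 ^ e) = Some (b (3 * 5 ^ e)) \<and> b (f k) <\<^sub>O b (3 * 5 ^ e)" for k
      using IH b O' less2 by metis
  next
    fix x y z
    assume "phi B x = Some (b x) \<and> phi B y = Some (b y) \<and> b x <\<^sub>O b y"
      "phi B y = Some (b y) \<and> phi B z = Some (b z) \<and> b y <\<^sub>O b z"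
    then show "phi B x = Some (b x) \<and> phi B z = Some (b z) \<and> b x <\<^sub>O b z"
      by (blast intro: less_trans)
  qed
  show ?thesis
  proof (rule that)
    show "b 1 = 1" using B1 by (simp add: b_def)
    show "b (2 ^ a) = 2 ^ 2 ^ 2 ^ b a" if "kleene_O a" for a
      using B2[OF that] main[of a] main[of "2 ^ a"] that O_succ[OF that] by simp
    show "\<exists>e'. b (3 * 5 ^ e) = 2 ^ 2 ^ (3 * 5 ^ e') \<and> (\<forall>n. phi e' n = Some (b (f n)))"
      if f: "\<And>n. phi e n = Some (f n)" "\<And>n. f n <\<^sub>O f (Suc n)" for e f
    proof (intro exI conjI allI)
      show "b (3 * 5 ^ e) = 2 ^ 2 ^ (3 * 5 ^ curry_index \<beta> \<llangle>B, e\<rrangle>)"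
        using B3[of e] main[of "3 * 5 ^ e"] O_lim[OF f] by simp
      show "phi (curry_index \<beta> \<llangle>B, e\<rrangle>) n = Some (b (f n))" for n
        unfolding lim[OF f(1)] using main f(2)[of n] by blast
    qed
    show "b x <\<^sub>O b y" if "x <\<^sub>O y" for x y using main that by blast
  qed
qed

section \<open>Families of relations closed under the jump\<close>

text \<open>If the classes of \<open>E\<close> code values \<open>\<phi>\<close>, a jump codes sets
  of values: the closure of a set of codes depends only on the values coded, and determines
  them.\<close>

lemma jump_iff_image_eq:
  assumes "equiv UNIV E" and "\<And>x y. (u x, u y) \<in> E \<longleftrightarrow> \<phi> x = \<phi> y"
    and "W X = u ` S" and "W Y = u ` S'"
  shows "(X, Y) \<in> jump E \<longleftrightarrow> \<phi> ` S = \<phi> ` S'"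
proof -
  have sub: "E `` (u ` S) \<subseteq> E `` (u ` S') \<longleftrightarrow> \<phi> ` S \<subseteq> \<phi> ` S'" for S S'
  proof
    assume L: "E `` (u ` S) \<subseteq> E `` (u ` S')"
    show "\<phi> ` S \<subseteq> \<phi> ` S'"
    proof
      fix c assume "c \<in> \<phi> ` S"
      then obtain s where s: "s \<in> S" "c = \<phi> s" by blast
      then have "u s \<in> E `` (u ` S)" using assms(2)[of s s] by blast
      then obtain s' where "s' \<in> S'" "(u s', u s) \<in> E" using L by blast
      then show "c \<in> \<phi> ` S'" using s(2) assms(2) by (metis imageI)
    qed
  next
    assume R: "\<phi> ` S \<subseteq> \<phi> ` S'"
    show "E `` (u ` S) \<subseteq> E `` (u ` S')"
    proof
      fix c assume "c \<in> E `` (u ` S)"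
      then obtain s where s: "s \<in> S" "(u s, c) \<in> E" by blast
      then obtain s' where s': "s' \<in> S'" "\<phi> s' = \<phi> s" using R by force
      then have "(u s', c) \<in> E" using s(2) assms(1,2) by (meson equivE transD)
      then show "c \<in> E `` (u ` S')" using s'(1) by blast
    qed
  qed
  show ?thesis by (simp add: jump_def assms(3,4) set_eq_subset sub)
qed

section \<open>Doubletons, truth values and the enumerations used for coding\<close>

abbreviation doubleton_enum :: "nat \<Rightarrow> nat option" where
  "doubleton_enum \<equiv> \<lambda>y. Some (if p2 y = 0 then p1 (p1 y) else p2 (p1 y))"

lemma pcomputable_doubleton_enum: "pcomputable doubleton_enum"
  by (intro pcomputable_intros computable_intros)

definition doubleton :: "(nat \<Rightarrow> nat) \<Rightarrow> nat \<Rightarrow> nat \<Rightarrow> nat" where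
  "doubleton r x y = r (range_index doubleton_enum \<llangle>x, y\<rrangle>)"

lemma W_doubleton: "W (range_index doubleton_enum \<llangle>x, y\<rrangle>) = {x, y}"
  unfolding W_range_index[OF pcomputable_doubleton_enum] by (auto split: if_splits intro: exI[of _ 0] exI[of _ 1])

lemma computable_doubleton:
  assumes "computable r" "computable f" "computable g"
  shows "computable (\<lambda>x. doubleton r (f x) (g x))"
  unfolding doubleton_def
  by (intro computable_comp[OF assms(1)] computable_range_index[OF pcomputable_doubleton_enum] computable_intros assms)

text \<open>
  The indices 0 and 1 stand for the constants "false" and "true", and \<open>i + 2\<close> for the statement
  \<open>i \<in> A\<close>; hence a coding of \<open>truth A\<close> carries its two classes along.
\<close>

definition truth :: "nat set \<Rightarrow> nat \<Rightarrow> bool" where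
  "truth A i \<longleftrightarrow> i = 1 \<or> (i \<ge> 2 \<and> i - 2 \<in> A)"

text \<open>
  The argument \<open>w = Suc z\<close> stands for "\<open>z\<close> agrees with \<open>A\<close>" and \<open>w = 0\<close> for "false". An oracle answer
  is correct iff the doubleton of the queried statement and the answer has a single truth value. Both
  such singletons are always listed, so that only a wrong answer, which gives \<open>{False, True}\<close>, changes
  the set; this takes care of positive and negative answers alike.
\<close>

definition query_pair :: "nat \<Rightarrow> nat \<Rightarrow> nat" where
  "query_pair w s =
    (if s = 0 then \<llangle>0, 0\<rrangle> else if s = 1 then \<llangle>1, 1\<rrangle> else if w = 0 then \<llangle>0, 1\<rrangle>
     else if s - 2 < p2 (w - 1) then \<llangle>s, p1 (w - 1) div 2 ^ (s - 2) mod 2\<rrangle> else \<llangle>0, 0\<rrangle>)"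

text \<open>Values follow the convention of \<open>query_pair\<close>: 0 is "false", and
  \<open>Suc \<llangle>0, 0\<rrangle>\<close> is the oracle of length 0, which is always correct.
  For \<open>n = e + 2\<close> the numbers \<open>Suc \<llangle>z, s\<rrangle>\<close> list the
  oracles \<open>z\<close> with which program \<open>e\<close> halts on \<open>e\<close> within
  \<open>s\<close> steps.\<close>

definition halting_oracle :: "nat \<Rightarrow> nat \<Rightarrow> nat" where
  "halting_oracle n s =
    (if s = 0 \<or> n = 0 then 0 else if n = 1 then Suc \<llangle>0, 0\<rrangle>
     else if outcome (p1 (s - 1)) (p2 (s - 1)) (n - 2) (n - 2) = 0 then 0 else Suc (p1 (s - 1)))"

text \<open>
  At a limit let \<open>C\<close> be the set of the codes of "true" of all levels. Adding a code at level \<open>m\<close> gives \<open>C\<close>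
  back if the coded statement holds and a set \<open>B m\<close> otherwise. Collecting this set together with all
  \<open>B m\<close> makes the result independent of \<open>m\<close>.
\<close>

definition level_pair :: "nat \<Rightarrow> nat" where
  "level_pair n = (if n = 0 then \<llangle>0, 0\<rrangle> else if n = 1 then \<llangle>0, 1\<rrangle>
     else \<llangle>p1 (n - 2), Suc (Suc (p2 (n - 2)))\<rrangle>)"

definition true_or :: "nat \<Rightarrow> nat \<Rightarrow> nat" where
  "true_or p s = (if s = 0 then p else \<llangle>s - 1, 1\<rrangle>)"

definition false_or_level :: "nat \<Rightarrow> nat \<Rightarrow> nat" where
  "false_or_level n s = (if s = 0 then level_pair n else \<llangle>s - 1, 0\<rrangle>)"

lemma decidable_disj: "decidable P \<Longrightarrow> decidable Q \<Longrightarrow> decidable (\<lambda>x. P x \<or> Q x)"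
  using decidable_not[OF decidable_conj[OF decidable_not decidable_not]] by simp

lemma computable_query_pair:
  "computable f \<Longrightarrow> computable g \<Longrightarrow> computable (\<lambda>x. query_pair (f x) (g x))"
  unfolding query_pair_def by (intro computable_intros)

lemma computable_halting_oracle:
  "computable f \<Longrightarrow> computable g \<Longrightarrow> computable (\<lambda>x. halting_oracle (f x) (g x))"
  unfolding halting_oracle_def by (intro decidable_disj computable_outcome computable_intros)

lemma computable_true_or:
  "computable f \<Longrightarrow> computable g \<Longrightarrow> computable (\<lambda>x. true_or (f x) (g x))"
  unfolding true_or_def by (intro computable_intros)

lemma computable_false_or_level:
  "computable f \<Longrightarrow> computable g \<Longrightarrow> computable (\<lambda>x. false_or_level (f x) (g x))"
  unfolding false_or_level_def level_pair_def by (intro computable_intros)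

lemma truth_0 [simp]: "\<not> truth A 0" and truth_1 [simp]: "truth A 1" "truth A (Suc 0)"
  and truth_Suc_Suc [simp]: "truth A (Suc (Suc i)) \<longleftrightarrow> i \<in> A"
  by (auto simp: truth_def)

lemma truth_mod_2 [simp]: "truth A (m mod 2) \<longleftrightarrow> odd m"
  by (simp add: mod2_eq_if)

lemma range_nat_eq: "range g = insert (g 0) (range (\<lambda>k. g (Suc k)))"
proof -
  have "g n \<in> insert (g 0) (range (\<lambda>k. g (Suc k)))" for n by (cases n) auto
  then show ?thesis by blast
qed

definition oracle_correct :: "nat set \<Rightarrow> nat \<Rightarrow> bool" where
  "oracle_correct A w \<longleftrightarrow> w \<noteq> 0 \<and> agrees (w - 1) A"

lemma query_pair_truth:
  "range (\<lambda>s. {truth A (p1 (query_pair w s)), truth A (p2 (query_pair w s))}) =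
    (if oracle_correct A w then {{False}, {True}} else {{False}, {True}, {False, True}})"
    (is "range ?T = _")
proof -
  have T0: "?T 0 = {False}" and T1: "?T 1 = {True}" by (simp_all add: query_pair_def)
  have cases: "?T s \<in> {{False}, {True}, {False, True}}" for s by (auto simp: insert_commute)
  have TS: "?T (Suc (Suc k)) = (if w = 0 then {False, True}
      else if k < p2 (w - 1) then {k \<in> A, k \<in> set_decode (p1 (w - 1))} else {False})" for k
    by (auto simp: query_pair_def set_decode_def)
  \<comment> \<open>Position \<open>k + 2\<close> tests the oracle digit \<open>k\<close>, so the
    mixed set appears exactly when a digit is wrong or \<open>w\<close> is 0.\<close>
  have ex: "(\<exists>s. ?T s = {False, True}) \<longleftrightarrow> \<not> oracle_correct A w"
  proof
    assume "\<exists>s. ?T s = {False, True}"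
    then obtain s where s: "?T s = {False, True}" by blast
    have "s \<noteq> 0" "s \<noteq> 1" using s T0 T1 by (metis insertI1 insert_iff singletonD singletonI)+
    then obtain k where "s = Suc (Suc k)" by (metis One_nat_def not0_implies_Suc)
    then show "\<not> oracle_correct A w" using s TS[of k]
      by (auto simp: oracle_correct_def agrees_def doubleton_eq_iff split: if_splits)
  next
    assume "\<not> oracle_correct A w"
    then consider "w = 0" | k where "w \<noteq> 0" "k < p2 (w - 1)" "k \<in> set_decode (p1 (w - 1)) \<longleftrightarrow> k \<notin> A"
      unfolding oracle_correct_def agrees_def by blast
    then show "\<exists>s. ?T s = {False, True}"
    proof cases
      case 1
      then show ?thesis using TS[of 0] by auto
    next
      case 2
      then show ?thesis using TS[of k] by (intro exI[of _ "Suc (Suc k)"]) auto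
    qed
  qed
  have in_range: "c \<in> range g \<longleftrightarrow> (\<exists>s. g s = c)" for c and g :: "nat \<Rightarrow> bool set" by auto
  have shape: "G = (if P then {a, b} else {a, b, c})"
    if "a \<in> G" "b \<in> G" "G \<subseteq> {a, b, c}" "c \<in> G \<longleftrightarrow> \<not> P" for G P and a b c :: "bool set"
    using that by auto
  show ?thesis
  proof (rule shape)
    show "{False} \<in> range ?T" unfolding in_range by (rule exI[of _ 0]) (rule T0)
    show "{True} \<in> range ?T" unfolding in_range by (rule exI[of _ 1]) (rule T1)
    show "range ?T \<subseteq> {{False}, {True}, {False, True}}" using cases by blast
    show "{False, True} \<in> range ?T \<longleftrightarrow> \<not> oracle_correct A w" unfolding in_range by (rule ex)
  qed
qed

text \<open>Position 0 always contributes "false", so the range depends only on whether some listed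
  oracle is correct, which is convergence by \<open>phi_rel_dom_iff\<close>.\<close>

lemma halting_oracle_correct:
  "range (\<lambda>s. oracle_correct A (halting_oracle n s)) =
    (if truth (turing_jump A) n then {False, True} else {False})"
proof -
  have F: "\<not> oracle_correct A (halting_oracle n 0)" by (simp add: oracle_correct_def halting_oracle_def)
  have "(\<exists>s. oracle_correct A (halting_oracle n s)) \<longleftrightarrow> truth (turing_jump A) n"
  proof -
    consider "n = 0" | "n = 1" | e where "n = Suc (Suc e)" by (metis One_nat_def not0_implies_Suc)
    then show ?thesis
    proof cases
      case 3
      have "oracle_correct A (halting_oracle n (Suc \<llangle>z, s\<rrangle>)) \<longleftrightarrow> agrees z A \<and> outcome z s e e \<noteq> 0" for z s
        by (simp add: oracle_correct_def halting_oracle_def 3)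
      moreover have "\<exists>z s'. s = Suc \<llangle>z, s'\<rrangle>" if "oracle_correct A (halting_oracle n s)" for s
        using that F by (cases s) (auto, metis prod_decode_inverse surj_pair)
      ultimately have "(\<exists>s. oracle_correct A (halting_oracle n s)) \<longleftrightarrow> (\<exists>z s. agrees z A \<and> outcome z s e e \<noteq> 0)"
        by metis
      then show ?thesis using phi_rel_dom_iff[of A e e] by (simp add: 3 turing_jump_def)
    next
      case 2
      have "oracle_correct A (halting_oracle n 1)"
        by (simp add: 2 oracle_correct_def halting_oracle_def agrees_def)
      then show ?thesis using 2 by auto
    qed (auto simp: oracle_correct_def halting_oracle_def)
  qed
  then show ?thesis using F by (auto simp: image_iff)
qed


text \<open>Only reductions into the next relation are required, not equality with the jump or the
  sum, so that a constant family can qualify. \<open>c0\<close> and \<open>c1\<close> code "false"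
  and "true" at the lowest level.\<close>

locale jump_family =
  fixes R :: "nat \<Rightarrow> nat rel" and r l :: "nat \<Rightarrow> nat" and c0 c1 :: nat
  assumes equiv_R: "kleene_O a \<Longrightarrow> equiv UNIV (R a)"
    and computable_r: "computable r" and computable_l: "computable l"
    and r_iff: "kleene_O a \<Longrightarrow> (r x, r y) \<in> R (2 ^ a) \<longleftrightarrow> (x, y) \<in> jump (R a)"
    and l_iff: "\<lbrakk>\<And>n. phi e n = Some (f n); \<And>n. f n <\<^sub>O f (Suc n)\<rbrakk> \<Longrightarrow>
      (l \<llangle>m, x\<rrangle>, l \<llangle>n, y\<rrangle>) \<in> R (3 * 5 ^ e) \<longleftrightarrow> m = n \<and> (x, y) \<in> R (f m)"
    and c0_c1: "(c0, c1) \<notin> R 1"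
begin

lemmas computable_r_comp = computable_comp[OF computable_r]
lemmas computable_l_comp = computable_comp[OF computable_l]
lemmas computable_dbl = computable_doubleton[OF computable_r]

lemma r_iff_image_eq:
  assumes "kleene_O a" and "\<And>x y. (u x, u y) \<in> R a \<longleftrightarrow> \<phi> x = \<phi> y"
    and "W X = u ` S" and "W Y = u ` S'"
  shows "(r X, r Y) \<in> R (2 ^ a) \<longleftrightarrow> \<phi> ` S = \<phi> ` S'"
  using r_iff[OF assms(1)] jump_iff_image_eq[OF equiv_R[OF assms(1)] assms(2-)] by simp

lemma doubleton_iff:
  assumes "kleene_O a" and "\<And>x y. (u x, u y) \<in> R a \<longleftrightarrow> \<phi> x = \<phi> y"
  shows "(doubleton r (u x) (u y), doubleton r (u x') (u y')) \<in> R (2 ^ a) \<longleftrightarrow> {\<phi> x, \<phi> y} = {\<phi> x', \<phi> y'}"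
  unfolding doubleton_def
  using r_iff_image_eq[OF assms, where S = "{x, y}" and S' = "{x', y'}"] by (simp add: W_doubleton)

section \<open>Coding the \<open>H\<close>-sets in a jump family\<close>

text \<open>
  Below \<open>F\<close> is an index of the coding function \<open>\<llangle>a, i\<rrangle> \<mapsto> f \<llangle>a, i\<rrangle>\<close> of \<open>H_set_coding\<close>, which refers to
  itself through the recursion theorem.
\<close>

definition queries :: "nat \<Rightarrow> nat option" where
  "queries y = (let F = p1 (p1 (p1 y)); a = p2 (p1 (p1 y)); p = query_pair (p2 (p1 y)) (p2 y) in
     Option.bind (phi F \<llangle>a, p1 p\<rrangle>) (\<lambda>u. Option.bind (phi F \<llangle>a, p2 p\<rrangle>) (\<lambda>v. Some (doubleton r u v))))"

text \<open>The argument is \<open>\<llangle>\<llangle>\<llangle>F, a\<rrangle>, n\<rrangle>,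
  s\<rrangle>\<close>: the parameters, the statement \<open>n\<close> about the Turing jump, and the
  position \<open>s\<close> in its list of oracles. Each entry is a code of the correctness of one
  oracle.\<close>

definition computations :: "nat \<Rightarrow> nat option" where
  "computations y = Some (r (range_index queries \<llangle>p1 (p1 y), halting_oracle (p2 (p1 y)) (p2 y)\<rrangle>))"

definition level_entries :: "nat \<Rightarrow> nat option" where
  "level_entries y = (let F = p1 (p1 (p1 y)); e = p2 (p1 (p1 y)); p = true_or (p2 (p1 y)) (p2 y) in
     Option.bind (phi e (p1 p)) (\<lambda>a. Option.bind (phi F \<llangle>a, p2 p\<rrangle>) (\<lambda>v. Some (l \<llangle>p1 p, v\<rrangle>))))"

definition levels :: "nat \<Rightarrow> nat option" where
  "levels y = Some (r (range_index level_entries \<llangle>p1 (p1 y), false_or_level (p2 (p1 y)) (p2 y)\<rrangle>))"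

lemma pcomputable_queries: "pcomputable queries"
  unfolding queries_def[abs_def] Let_def
  by (intro pcomputable_intros computable_dbl computable_query_pair computable_intros)

lemma pcomputable_computations: "pcomputable computations"
  unfolding computations_def[abs_def]
  by (intro pcomputable_intros computable_r_comp computable_range_index[OF pcomputable_queries]
      computable_halting_oracle computable_intros)

lemma pcomputable_level_entries: "pcomputable level_entries"
  unfolding level_entries_def[abs_def] Let_def
  by (intro pcomputable_intros computable_l_comp computable_true_or computable_intros)

lemma pcomputable_levels: "pcomputable levels"
  unfolding levels_def[abs_def]
  by (intro pcomputable_intros computable_r_comp computable_range_index[OF pcomputable_level_entries]
      computable_false_or_level computable_intros)

lemma W_range_index_image:
  assumes "pcomputable \<psi>" and "\<And>s. \<psi> \<llangle>x, s\<rrangle> = Some (u (g s))"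
  shows "W (range_index \<psi> x) = u ` range g"
  unfolding W_range_index[OF assms(1)] assms(2) by auto

text \<open>Each jump has one task: the first codes doubletons of truth values, the second the
  correctness of a finite oracle as a set of them, the third halting as the existence of a correct
  oracle.\<close>

lemma successor_coding:
  assumes a: "kleene_O b" and F: "\<And>i. phi F \<llangle>a, i\<rrangle> = Some (f i)"
    and f: "\<And>i j. (f i, f j) \<in> R b \<longleftrightarrow> truth A i = truth A j"
  shows "(r (range_index computations \<llangle>\<llangle>F, a\<rrangle>, i\<rrangle>), r (range_index computations \<llangle>\<llangle>F, a\<rrangle>, j\<rrangle>)) \<in> R (2 ^ 2 ^ 2 ^ b)
    \<longleftrightarrow> truth (turing_jump A) i = truth (turing_jump A) j"
proof -
  define u where "u p = doubleton r (f (p1 p)) (f (p2 p))" for p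
  define v where "v w = r (range_index queries \<llangle>\<llangle>F, a\<rrangle>, w\<rrangle>)" for w
  note O = O_succ[OF a] O_succ[OF O_succ[OF a]]
  have u: "(u p, u q) \<in> R (2 ^ b) \<longleftrightarrow> {truth A (p1 p), truth A (p2 p)} = {truth A (p1 q), truth A (p2 q)}" for p q
    unfolding u_def by (rule doubleton_iff[OF a f])
  have W1: "W (range_index queries \<llangle>\<llangle>F, a\<rrangle>, w\<rrangle>) = u ` range (query_pair w)" for w
    by (rule W_range_index_image[OF pcomputable_queries]) (simp add: queries_def Let_def F u_def)
  have v: "(v w, v w') \<in> R (2 ^ 2 ^ b) \<longleftrightarrow> oracle_correct A w = oracle_correct A w'" for w w'
    unfolding v_def r_iff_image_eq[OF O(1) u W1 W1] image_image query_pair_truth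
    by (auto simp: doubleton_eq_iff)
  have W2: "W (range_index computations \<llangle>\<llangle>F, a\<rrangle>, n\<rrangle>) = v ` range (halting_oracle n)" for n
    by (rule W_range_index_image[OF pcomputable_computations]) (simp add: computations_def v_def)
  show ?thesis
    unfolding r_iff_image_eq[OF O(2) v W2 W2] image_image halting_oracle_correct
    by auto
qed

lemma limit_coding:
  assumes b: "\<And>m. phi e' m = Some (b m)" "\<And>m. b m <\<^sub>O b (Suc m)"
    and e: "\<And>m. phi e m = Some (g m)"
    and F: "\<And>m i. phi F \<llangle>g m, i\<rrangle> = Some (f m i)"
    and f: "\<And>m i j. (f m i, f m j) \<in> R (b m) \<longleftrightarrow> truth (A m) i = truth (A m) j"
  defines "H \<equiv> {\<llangle>m, x\<rrangle> | m x. x \<in> A m}"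
  shows "(r (range_index levels \<llangle>\<llangle>F, e\<rrangle>, i\<rrangle>), r (range_index levels \<llangle>\<llangle>F, e\<rrangle>, j\<rrangle>)) \<in> R (2 ^ 2 ^ (3 * 5 ^ e'))
    \<longleftrightarrow> truth H i = truth H j"
proof -
  define T where "T p = (p1 p, truth (A (p1 p)) (p2 p))" for p
  define C where "C = range (\<lambda>m::nat. (m, True))"
  define u where "u p = l \<llangle>p1 p, f (p1 p) (p2 p)\<rrangle>" for p
  define v where "v p = r (range_index level_entries \<llangle>\<llangle>F, e\<rrangle>, p\<rrangle>)" for p
  have O0: "kleene_O (3 * 5 ^ e')" using b by (rule O_lim)
  note O = O0 O_succ[OF O0]
  have u: "(u p, u q) \<in> R (3 * 5 ^ e') \<longleftrightarrow> T p = T q" for p q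
  proof -
    have "(u p, u q) \<in> R (3 * 5 ^ e') \<longleftrightarrow> p1 p = p1 q \<and> (f (p1 p) (p2 p), f (p1 q) (p2 q)) \<in> R (b (p1 p))"
      unfolding u_def by (rule l_iff[OF b])
    also have "\<dots> \<longleftrightarrow> T p = T q" unfolding T_def prod.inject by (metis f)
    finally show ?thesis .
  qed
  have W1: "W (range_index level_entries \<llangle>\<llangle>F, e\<rrangle>, p\<rrangle>) = u ` range (true_or p)" for p
    by (rule W_range_index_image[OF pcomputable_level_entries]) (simp add: level_entries_def Let_def e F u_def)
  have T: "T ` range (true_or p) = insert (T p) C" for p
  proof -
    have "range (true_or p) = insert p (range (\<lambda>m. \<llangle>m, 1\<rrangle>))"
      by (subst range_nat_eq) (simp add: true_or_def)
    then show ?thesis by (simp only: image_insert image_image) (simp add: T_def C_def)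
  qed
  have v: "(v p, v q) \<in> R (2 ^ (3 * 5 ^ e')) \<longleftrightarrow> insert (T p) C = insert (T q) C" for p q
    unfolding v_def r_iff_image_eq[OF O(1) u W1 W1] T ..
  have W2: "W (range_index levels \<llangle>\<llangle>F, e\<rrangle>, n\<rrangle>) = v ` range (false_or_level n)" for n
    by (rule W_range_index_image[OF pcomputable_levels]) (simp add: levels_def v_def)
  define B where "B = range (\<lambda>m. insert (m, False) C)"
  \<comment> \<open>The one entry depending on \<open>n\<close> is \<open>C\<close> if the statement
    holds, and otherwise some \<open>insert (m, False) C\<close>, which \<open>B\<close> contains
    already; so the level of the statement leaves no trace.\<close>
  have "(\<lambda>p. insert (T p) C) ` range (false_or_level n) = (if truth H n then insert C B else B)" for n
  proof -
    have "range (false_or_level n) = insert (level_pair n) (range (\<lambda>m. \<llangle>m, 0\<rrangle>))"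
      by (subst range_nat_eq) (simp add: false_or_level_def)
    then have "(\<lambda>p. insert (T p) C) ` range (false_or_level n) = insert (insert (T (level_pair n)) C) B"
      by (simp only: image_insert image_image) (simp add: T_def B_def)
    moreover have "truth (A (p1 (level_pair n))) (p2 (level_pair n)) = truth H n"
    proof -
      consider "n = 0" | "n = 1" | k where "n = Suc (Suc k)" by (metis One_nat_def not0_implies_Suc)
      then show ?thesis
      proof cases
        case 3
        have "k \<in> H \<longleftrightarrow> p2 k \<in> A (p1 k)"
          unfolding H_def by (auto, metis prod.collapse prod_decode_inverse)
        then show ?thesis by (simp add: level_pair_def 3)
      qed (simp_all add: level_pair_def)
    qed
    ultimately show ?thesis by (auto simp: T_def B_def C_def)
  qed
  moreover have "C \<notin> B" unfolding B_def C_def by auto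
  ultimately show ?thesis
    unfolding r_iff_image_eq[OF O(2) v W2 W2] by auto
qed

lemma H_set_coding:
  obtains b f where "\<And>a. kleene_O a \<Longrightarrow> kleene_O (b a)" "computable f"
    "\<And>a i j. kleene_O a \<Longrightarrow> (f \<llangle>a, i\<rrangle>, f \<llangle>a, j\<rrangle>) \<in> R (b a) \<longleftrightarrow> truth (H_set a) i = truth (H_set a) j"
proof -
  obtain b where b1: "b 1 = 1" and bs: "\<And>a. kleene_O a \<Longrightarrow> b (2 ^ a) = 2 ^ 2 ^ 2 ^ b a"
    and bl: "\<And>e f. \<lbrakk>\<And>n. phi e n = Some (f n); \<And>n. f n <\<^sub>O f (Suc n)\<rbrakk> \<Longrightarrow>
      \<exists>e'. b (3 * 5 ^ e) = 2 ^ 2 ^ (3 * 5 ^ e') \<and> (\<forall>n. phi e' n = Some (b (f n)))"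
    and mono: "\<And>x y. x <\<^sub>O y \<Longrightarrow> b x <\<^sub>O b y"
    by (rule notation_map) blast
  have bO: "kleene_O (b a)" if "kleene_O a" for a
    using mono[OF less_succ[OF that]] kleene_less_O by blast
  \<comment> \<open>Only indices mentioning \<open>F\<close> are formed and nothing is evaluated at
    smaller notations, so \<open>q\<close> is total even outside Kleene's system.\<close>
  define q where "q y = (let F = p1 y; a = p1 (p2 y); n = p2 (p2 y) in
     if a = 1 then if n = 1 then c1 else c0
     else if a mod 3 = 0 then r (range_index levels \<llangle>\<llangle>F, lim_index a\<rrangle>, n\<rrangle>)
     else r (range_index computations \<llangle>\<llangle>F, log2 a\<rrangle>, n\<rrangle>))" for y
  have "computable q" unfolding q_def[abs_def] Let_def
    by (intro computable_r_comp computable_range_index[OF pcomputable_levels] computable_lim_index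
        computable_range_index[OF pcomputable_computations] computable_log2 computable_intros)
  then have "pcomputable (\<lambda>y. Some (q y))" by (rule pcomputable_Some)
  then obtain F where F: "\<And>y. phi F y = Some (q \<llangle>F, y\<rrangle>)" by (rule recursion_theorem) blast
  define f where "f y = q \<llangle>F, y\<rrangle>" for y
  have f1: "f \<llangle>1, n\<rrangle> = (if n = 1 then c1 else c0)" for n by (simp add: f_def q_def)
  have fs: "f \<llangle>2 ^ a, n\<rrangle> = r (range_index computations \<llangle>\<llangle>F, a\<rrangle>, n\<rrangle>)" if "kleene_O a" for a n
    using power_two_mod_three[of a] kleene_O_power_neq_one[OF that] by (simp add: f_def q_def Let_def)
  have fl: "f \<llangle>3 * 5 ^ e, n\<rrangle> = r (range_index levels \<llangle>\<llangle>F, e\<rrangle>, n\<rrangle>)" for e n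
    by (simp add: f_def q_def Let_def)
  show ?thesis
  proof (rule that[OF bO])
    show "computable f" unfolding f_def[abs_def] using \<open>computable q\<close>
      by (rule computable_comp) (intro computable_intros)
    show "(f \<llangle>a, i\<rrangle>, f \<llangle>a, j\<rrangle>) \<in> R (b a) \<longleftrightarrow> truth (H_set a) i = truth (H_set a) j" if "kleene_O a" for a i j
      using that
    proof (induction a arbitrary: i j rule: kleene_O_induct)
      case zero
      have "equiv UNIV (R 1)" using equiv_R[OF O_zero[unfolded One_nat_def]] by simp
      then have "(c, c) \<in> R 1" "(c1, c0) \<notin> R 1" for c
        using c0_c1 by (auto elim!: equivE dest: refl_onD symD)
      moreover have "H_set 1 = {}" unfolding H_set_def by (rule O_rec_zero)
      ultimately show ?case using c0_c1 unfolding f1 b1 by (auto simp: truth_def)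
    next
      case (succ a)
      have "H_set (2 ^ a) = turing_jump (H_set a)" unfolding H_set_def by (rule O_rec_succ[OF succ(1)])
      then show ?case unfolding fs[OF succ(1)] bs[OF succ(1)]
        using successor_coding[OF bO[OF succ(1)] _ succ.IH] F f_def by simp
    next
      case (lim e g)
      obtain e' where e': "b (3 * 5 ^ e) = 2 ^ 2 ^ (3 * 5 ^ e')" "\<And>n. phi e' n = Some (b (g n))"
        using bl[OF lim(1,2)] by blast
      have "H_set (3 * 5 ^ e) = {\<llangle>m, x\<rrangle> | m x. x \<in> H_set (g m)}"
        unfolding H_set_def by (rule O_rec_lim[OF lim(1,2)])
      then show ?case unfolding fl e'(1)
        using limit_coding[OF e'(2) mono[OF lim(2)] lim(1) _ lim(3)] F f_def by simp
    qed
  qed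
qed

section \<open>Reducing a hyperarithmetic equivalence relation to a member of the family\<close>

lemma HYP_reducible:
  assumes "equiv UNIV X" and "HYP X"
  shows "\<exists>a. kleene_O a \<and> X \<preceq> R a"
proof -
  obtain a where a: "kleene_O a" "prod_encode ` X \<le>\<^sub>T H_set a"
    using assms(2) unfolding HYP_def hyperarithmetic_def by blast
  obtain k where k: "computable k" "\<And>n. n \<in> prod_encode ` X \<longleftrightarrow> k n \<in> turing_jump (H_set a)"
    using turing_le_jump_reduction[OF a(2)] by blast
  \<comment> \<open>Going up to the Turing jump replaces the Turing reduction by the many-one
    reduction \<open>k\<close>.\<close>
  have a': "kleene_O (2 ^ a)" using a(1) by (rule O_succ)
  have H: "H_set (2 ^ a) = turing_jump (H_set a)" unfolding H_set_def by (rule O_rec_succ[OF a(1)])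
  obtain b f where b: "\<And>a. kleene_O a \<Longrightarrow> kleene_O (b a)" and f: "computable f"
    "\<And>a i j. kleene_O a \<Longrightarrow> (f \<llangle>a, i\<rrangle>, f \<llangle>a, j\<rrangle>) \<in> R (b a) \<longleftrightarrow> truth (H_set a) i = truth (H_set a) j"
    by (rule H_set_coding) blast
  define t where "t p = f \<llangle>2 ^ a, Suc (Suc (k p))\<rrangle>" for p
  have t: "computable t" "\<And>p q. (t p, t q) \<in> R (b (2 ^ a)) \<longleftrightarrow> (p \<in> prod_encode ` X) = (q \<in> prod_encode ` X)"
    unfolding t_def[abs_def]
    by (intro computable_comp[OF f(1)] computable_comp[OF k(1)] computable_intros)
      (simp add: f(2)[OF a'] H k(2))
  \<comment> \<open>Iterating the successor from \<open>b (2 ^ a)\<close> gives a fundamental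
    sequence whose limit relation has one position for every natural number
    \<open>y\<close>.\<close>
  define d where "d n = ((\<lambda>x::nat. 2 ^ x :: nat) ^^ n) (b (2 ^ a))" for n
  have rec: "rec_nat x (\<lambda>k. g) n = (g ^^ n) x" for x n and g :: "nat \<Rightarrow> nat"
    by (induction n) simp_all
  have d: "d 0 = b (2 ^ a)" "\<And>n. d (Suc n) = 2 ^ d n" by (simp_all add: d_def)
  have dO: "kleene_O (d n)" for n by (induction n) (simp_all add: d b a' O_succ)
  have "computable (\<lambda>n. rec_nat (b (2 ^ a)) (\<lambda>k x. 2 ^ x) n)"
    by (intro computable_rec_nat computable_intros)
  then obtain e where e: "\<And>n. phi e n = Some (d n)"
    unfolding computable_def rec d_def by blast
  have d_less: "d n <\<^sub>O d (Suc n)" for n unfolding d using dO by (rule less_succ)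
  \<comment> \<open>Iterated singletons carry a truth code from level \<open>b (2 ^ a)\<close> up to
    level \<open>d n\<close> without identifying or separating classes.\<close>
  define s where "s n x = ((\<lambda>x. doubleton r x x) ^^ n) x" for n x
  have s: "(s n x, s n y) \<in> R (d n) \<longleftrightarrow> (x, y) \<in> R (b (2 ^ a))" for n x y
  proof (induction n arbitrary: x y)
    case (Suc n)
    have "(x, y) \<in> R (d n) \<longleftrightarrow> R (d n) `` {x} = R (d n) `` {y}" for x y
      using equiv_R[OF dO[of n]] by (simp add: eq_equiv_class_iff)
    from doubleton_iff[OF dO this, of "\<lambda>x. x"] show ?case
      using Suc equiv_R[OF dO[of n]] by (simp add: s_def d eq_equiv_class_iff)
  qed (simp add: s_def d)
  have comp_s: "computable (\<lambda>x. s (g x) (h x))" if "computable g" "computable h" for g h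
  proof -
    have "computable (\<lambda>x. rec_nat (h x) (\<lambda>k x. doubleton r x x) (g x))"
      by (intro computable_rec_nat computable_dbl computable_intros that)
    then show ?thesis by (simp only: rec s_def)
  qed
  \<comment> \<open>For \<open>p = \<llangle>x, y\<rrangle>\<close> the position records
    \<open>y\<close> and the entry there codes whether \<open>x\<close> and \<open>y\<close> are
    related.\<close>
  define u where "u p = l \<llangle>p2 p, s (p2 p) (t p)\<rrangle>" for p
  have u: "(u p, u q) \<in> R (3 * 5 ^ e) \<longleftrightarrow> (p2 p, p \<in> prod_encode ` X) = (p2 q, q \<in> prod_encode ` X)" for p q
    unfolding u_def l_iff[OF e d_less] using s t(2) by auto
  have pu: "pcomputable (\<lambda>p. Some (u p))" unfolding u_def
    by (intro pcomputable_intros computable_l_comp comp_s computable_comp[OF t(1)] computable_intros)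
  \<comment> \<open>\<open>h x\<close> names the set of the codes
    \<open>u \<llangle>x, y\<rrangle>\<close> for all \<open>y\<close>, that is, the characteristic
    function of the class of \<open>x\<close>.\<close>
  define h where "h x = r (range_index (\<lambda>p. Some (u p)) x)" for x
  have O: "kleene_O (3 * 5 ^ e)" using e d_less by (rule O_lim)
  have Wh: "W (range_index (\<lambda>p. Some (u p)) x) = u ` range (\<lambda>y. \<llangle>x, y\<rrangle>)" for x
    by (rule W_range_index_image[OF pu]) simp
  have "(h x, h y) \<in> R (2 ^ (3 * 5 ^ e)) \<longleftrightarrow>
      range (\<lambda>z. (z, (x, z) \<in> X)) = range (\<lambda>z. (z, (y, z) \<in> X))" for x y
    unfolding h_def r_iff_image_eq[OF O u Wh Wh] image_image by (simp add: inj_image_mem_iff inj_prod_encode)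
  moreover have "range (\<lambda>z. (z, (x, z) \<in> X)) = range (\<lambda>z. (z, (y, z) \<in> X)) \<longleftrightarrow> (x, y) \<in> X" for x y
  proof -
    have "range (\<lambda>z. (z, (x, z) \<in> X)) = range (\<lambda>z. (z, (y, z) \<in> X)) \<longleftrightarrow> (\<forall>z. (x, z) \<in> X \<longleftrightarrow> (y, z) \<in> X)"
      by (auto simp: set_eq_iff image_iff)
    also have "\<dots> \<longleftrightarrow> X `` {x} = X `` {y}" by auto
    finally show ?thesis using assms(1) by (simp add: eq_equiv_class_iff)
  qed
  moreover have "computable h" unfolding h_def
    by (intro computable_r_comp computable_range_index[OF pu] computable_intros)
  ultimately have "X \<preceq> R (2 ^ (3 * 5 ^ e))" unfolding reducible_def by (intro exI[of _ h]) simp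
  with O_succ[OF O] show ?thesis by (intro exI conjI)
qed

end

section \<open>The two instances\<close>

lemma equiv_jump: "equiv UNIV (jump E)"
  by (auto simp: jump_def equiv_def refl_on_def sym_def trans_def)

lemma direct_sum_iff: "(\<llangle>m, x\<rrangle>, \<llangle>n, y\<rrangle>) \<in> direct_sum E \<longleftrightarrow> m = n \<and> (x, y) \<in> E m"
  by (auto simp: direct_sum_def)

lemma equiv_direct_sum:
  assumes "\<And>n. equiv UNIV (E n)" shows "equiv UNIV (direct_sum E)"
proof (rule equivI)
  have pair: "\<exists>m x. n = \<llangle>m, x\<rrangle>" for n by (metis prod_decode_inverse surj_pair)
  show "refl (direct_sum E)"
  proof (rule refl_onI)
    fix n obtain m x where "n = \<llangle>m, x\<rrangle>" using pair by blast
    then show "(n, n) \<in> direct_sum E" using assms[of m] by (auto simp: direct_sum_iff equiv_def refl_on_def)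
  qed
  show "sym (direct_sum E)"
    using assms by (auto simp: direct_sum_def equiv_def sym_def)
  show "trans (direct_sum E)"
    using assms unfolding direct_sum_def equiv_def trans_def by auto
qed simp

lemma equiv_jump_iter:
  assumes "kleene_O a" shows "equiv UNIV (jump_iter Id a)"
  using assms
proof (induction rule: kleene_O_induct)
  case zero
  show ?case by (simp only: jump_iter_zero) (simp add: equiv_def refl_on_def sym_Id trans_Id)
next
  case (succ b)
  then show ?case by (simp add: jump_iter_succ equiv_jump)
next
  case (lim e f)
  then show ?case by (simp only: jump_iter_lim[OF lim(1,2)] equiv_direct_sum)
qed

lemma jump_family_jump_iter: "jump_family (jump_iter Id) (\<lambda>x. x) (\<lambda>x. x) 0 1"
proof unfold_locales
  show "equiv UNIV (jump_iter Id a)" if "kleene_O a" for a using that by (rule equiv_jump_iter)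
  show "computable (\<lambda>x. x)" by (rule computable_id)
  show "(x, y) \<in> jump_iter Id (2 ^ a) \<longleftrightarrow> (x, y) \<in> jump (jump_iter Id a)" if "kleene_O a" for a x y
    unfolding jump_iter_succ[OF that] ..
  show "(0, 1) \<notin> jump_iter Id 1" by (simp only: jump_iter_zero) simp
  show "(\<llangle>m, x\<rrangle>, \<llangle>n, y\<rrangle>) \<in> jump_iter Id (3 * 5 ^ e) \<longleftrightarrow> m = n \<and> (x, y) \<in> jump_iter Id (f m)"
    if "\<And>n. phi e n = Some (f n)" "\<And>n. f n <\<^sub>O f (Suc n)" for e f m n x y
    unfolding jump_iter_lim[OF that] direct_sum_iff ..
qed

text \<open>The reduction \<open>r\<close> lets elements of \<open>E\<close> name c.e. sets of
  classes, so a fragment of set theory lives inside \<open>E\<close> and can encode the direct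
  sums.\<close>

lemma jump_family_fixed_point:
  assumes E: "equiv UNIV E" and "jump E \<preceq> E"
  obtains r l c0 c1 where "jump_family (\<lambda>_. E) r l c0 c1"
proof -
  obtain r where r: "computable r" "\<And>x y. (x, y) \<in> jump E \<longleftrightarrow> (r x, r y) \<in> E"
    using assms(2) unfolding reducible_def by blast
  let ?d = "doubleton r"
  define c where "c x = E `` {x}" for x
  have E_iff: "(x, y) \<in> E \<longleftrightarrow> c x = c y" for x y using E by (simp add: c_def eq_equiv_class_iff)
  have d: "(?d x y, ?d x' y') \<in> E \<longleftrightarrow> {c x, c y} = {c x', c y'}" for x y x' y'
    unfolding doubleton_def r(2)[symmetric]
    by (subst jump_iff_image_eq[OF E E_iff, where S = "{x, y}" and S' = "{x', y'}"]) (auto simp: W_doubleton)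
  have pe: "pcomputable (\<lambda>x. None)"
    unfolding pcomputable_def by (rule exI[of _ "Mu (const_prog 1)"]) (simp add: fun_eq_iff Let_def)
  have empty: "W (range_index (\<lambda>x. None) 0) = {}" by (simp add: W_range_index[OF pe])
  \<comment> \<open>A name of the empty set, which is never equivalent to a name of a
    singleton.\<close>
  define c0 where "c0 = r (range_index (\<lambda>x. None) 0)"
  have c0: "(c0, ?d x x) \<notin> E" for x
    unfolding c0_def doubleton_def r(2)[symmetric]
    by (subst jump_iff_image_eq[OF E E_iff, where S = "{}" and S' = "{x}"]) (auto simp: W_doubleton empty)
  \<comment> \<open>Zermelo numerals: iterated singletons of the empty set, pairwise inequivalent
    because forming singletons is injective on classes.\<close>
  define num where "num n = rec_nat c0 (\<lambda>k x. ?d x x) n" for n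
  have num: "(num m, num n) \<in> E \<longleftrightarrow> m = n" for m n
  proof (induction m arbitrary: n)
    case 0
    show ?case using c0 E by (cases n) (auto simp: num_def equiv_def refl_on_def)
  next
    case (Suc m)
    show ?case
    proof (cases n)
      case 0
      then show ?thesis using c0 E by (auto simp: num_def equiv_def sym_def)
    next
      case (Suc k)
      have "(num (Suc m), num (Suc k)) \<in> E \<longleftrightarrow> (num m, num k) \<in> E"
        using d by (simp add: num_def E_iff)
      then show ?thesis using Suc Suc.IH by simp
    qed
  qed
  have comp_num: "computable (\<lambda>x. num (g x))" if "computable g" for g
    unfolding num_def by (intro computable_rec_nat computable_doubleton r computable_intros that)
  have d_class: "c (?d x y) = c (?d x' y') \<longleftrightarrow> {c x, c y} = {c x', c y'}" for x y x' y'
    unfolding E_iff[symmetric] by (rule d)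
  have num_class: "c (num m) = c (num n) \<longleftrightarrow> m = n" for m n
    unfolding E_iff[symmetric] by (rule num)
  \<comment> \<open>The Kuratowski pair of the numeral of the position and the entry.\<close>
  define l where "l p = ?d (?d (num (p1 p)) (num (p1 p))) (?d (num (p1 p)) (p2 p))" for p
  show ?thesis
  proof (rule that[of r l "num 0" "num 1"], unfold_locales)
    show "computable l" unfolding l_def[abs_def]
      by (intro computable_doubleton r comp_num computable_intros)
    show "(l \<llangle>m, x\<rrangle>, l \<llangle>n, y\<rrangle>) \<in> E \<longleftrightarrow> m = n \<and> (x, y) \<in> E" for m n x y
      unfolding l_def d by (auto simp: doubleton_eq_iff d_class num_class E_iff)
  qed (use E r num in auto)
qed

theorem theorem1p13:
  "(\<forall>E :: nat rel. equiv UNIV E \<and> HYP E \<longrightarrow> (\<exists>a. kleene_O a \<and> E \<preceq> jump_iter Id a)) \<and>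
   (\<forall>E :: nat rel. equiv UNIV E \<and> E \<approx> jump E \<longrightarrow>
      (\<forall>R :: nat rel. equiv UNIV R \<and> HYP R \<longrightarrow> R \<preceq> E))"
proof (intro conjI allI impI)
  fix E :: "nat rel" assume "equiv UNIV E \<and> HYP E"
  then show "\<exists>a. kleene_O a \<and> E \<preceq> jump_iter Id a"
    using jump_family.HYP_reducible[OF jump_family_jump_iter] by blast
next
  fix E R :: "nat rel" assume E: "equiv UNIV E \<and> E \<approx> jump E" and R: "equiv UNIV R \<and> HYP R"
  then obtain r l c0 c1 where "jump_family (\<lambda>_. E) r l c0 c1"
    unfolding bireducible_def using jump_family_fixed_point by metis
  \<comment> \<open>Every member of the constant family is \<open>E\<close>, so the notation
    obtained does not matter.\<close>
  then show "R \<preceq> E" using jump_family.HYP_reducible R by blast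
qed

end
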